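(* Let $(\mathfrak{g}, \mathfrak{h}, \rho, \psi)$ be a matched pair of Lie algebras. Then there is a bijection $$\{ \text{infinitesimal deformations of } (\mathfrak{g}, \mathfrak{h}, \rho, \psi)\}/\sim \ \longleftrightarrow\ H^2_\mathrm{MPL} (\mathfrak{g}, \mathfrak{h}, \rho, \psi),$$ where $\sim$ denotes equivalence of infinitesimal deformations.
   Context: All vector spaces and (multi)linear maps are over a field $\mathbf{k}$ of characteristic zero. A matched pair of Lie algebras (over a commutative ring) is a quadruple $(\mathfrak{g}, \mathfrak{h}, \rho, \psi)$ with $\mathfrak{g},\mathfrak{h}$ Lie algebras and bilinear maps $\rho : \mathfrak{g} \times \mathfrak{h} \to \mathfrak{h}$, $\psi : \mathfrak{h} \times \mathfrak{g} \to \mathfrak{g}$ such that $\rho$ is a representation of $\mathfrak{g}$ on $\mathfrak{h}$, $\psi$ is a representation of $\mathfrak{h}$ on $\mathfrak{g}$, and for all $x,y\in\mathfrak{g}$, $h,k\in\mathfrak{h}$: $$\rho_x ([h, k]_\mathfrak{h}) = [\rho_x h , k]_\mathfrak{h} + [h, \rho_x k]_\mathfrak{h} + \rho_{\psi_k x} h - \rho_{\psi_h x} k,$$ $$\psi_h ([x, y]_\mathfrak{g}) = [\psi_h x , y]_\mathfrak{g} + [x, \psi_h y]_\mathfrak{g} + \psi_{\rho_y h} x - \psi_{\rho_x h} y.$$ A morphism $(\mathfrak{g},\mathfrak{h},\rho,\psi)\to(\mathfrak{g}',\mathfrak{h}',\rho',\psi')$ is a pair $(f,g)$ of Lie algebra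 homomorphisms $f:\mathfrak{g}\to\mathfrak{g}'$, $g:\mathfrak{h}\to\mathfrak{h}'$ with $g(\rho_xh)=\rho'_{f(x)}g(h)$ and $f(\psi_hx)=\psi'_{g(h)}f(x)$. An infinitesimal deformation of $(\mathfrak{g}, \mathfrak{h}, \rho, \psi)$ is a quadruple $(\mu_1,\nu_1,\rho_1,\psi_1)$ of bilinear maps $\mu_1 : \mathfrak{g} \times \mathfrak{g} \to \mathfrak{g}$, $\nu_1 : \mathfrak{h} \times \mathfrak{h} \to \mathfrak{h}$ (both skew-symmetric), $\rho_1 : \mathfrak{g} \times \mathfrak{h} \to \mathfrak{h}$, $\psi_1 : \mathfrak{h} \times \mathfrak{g} \to \mathfrak{g}$ such that $((\mathfrak{g}[t]/(t^2),\mu_t),(\mathfrak{h}[t]/(t^2),\nu_t),\rho_t,\psi_t)$ is a matched pair of Lie algebras over the ring $\mathbf{k}[t]/(t^2)$, where the $\mathbf{k}[t]/(t^2)$-bilinear maps are determined by $\mu_t(x,y)=[x,y]_\mathfrak{g}+t\mu_1(x,y)$, $\nu_t(h,k)=[h,k]_\mathfrak{h}+t\nu_1(h,k)$, $(\rho_t)_xh=\rho_xh+t(\rho_1)_xh$, $(\psi_t)_hx=\psi_hx+t(\psi_1)_hx$. Two infinitesimal deformations $(\mu_1,\nu_1,\rho_1,\psi_1)$ and $(\mu_1',\nu_1',\rho_1',\psi_1')$ are equivalent ($\sim$) if there are linear maps $f:\mathfrak{g}\to\mathfrak{g}$ and $g:\mathfrak{h}\to\mathfrak{h}$ such that $(\mathrm{id}_\mathfrak{g}+tf,\mathrm{id}_\mathfrak{h}+tg)$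 is a morphism of matched pairs from $((\mathfrak{g}[t]/(t^2),\mu_t),(\mathfrak{h}[t]/(t^2),\nu_t),\rho_t,\psi_t)$ to $((\mathfrak{g}[t]/(t^2),\mu'_t),(\mathfrak{h}[t]/(t^2),\nu'_t),\rho'_t,\psi'_t)$. Cohomology: $C^{k|l}$ ($k,l\ge0$) is the space of skew-symmetric $(k+l+1)$-linear maps on $\mathfrak{g}\oplus\mathfrak{h}$ with values in $\mathfrak{g}\oplus\mathfrak{h}$ sending $\wedge^{k+1}\mathfrak{g}\otimes\wedge^l\mathfrak{h}$ to $\mathfrak{g}$, $\wedge^k\mathfrak{g}\otimes\wedge^{l+1}\mathfrak{h}$ to $\mathfrak{h}$ and vanishing on the other summands $\wedge^a\mathfrak{g}\otimes\wedge^b\mathfrak{h}$. For $n\ge1$, $C^n(\mathfrak{g},\mathfrak{h},\rho,\psi)=C^{n-1|0}\oplus C^{n-2|1}\oplus\cdots\oplus C^{0|n-1}$, and $\delta_\mathrm{MPL}:C^n\to C^{n+1}$ is $\delta_\mathrm{MPL}(F)=-[\pi,F]_\mathrm{NR}$, where $\pi((x,h),(y,k))=([x,y]_\mathfrak{g}+\psi_hy-\psi_kx,[h,k]_\mathfrak{h}+\rho_xk-\rho_yh)$. Here for $f\in\mathrm{Hom}(\wedge^{m+1}E,E)$, $g\in\mathrm{Hom}(\wedge^{n+1}E,E)$, $[f,g]_\mathrm{NR}=i_fg-(-1)^{mn}i_gf$ with $(i_f g)(z_1,\ldots,z_{m+n+1})=\sum_{\sigma\in\mathrm{Sh}(m+1,n)}(-1)^\sigma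 g(f(z_{\sigma(1)},\ldots,z_{\sigma(m+1)}),z_{\sigma(m+2)},\ldots,z_{\sigma(m+n+1)})$. One has $\delta_\mathrm{MPL}^2=0$, and $H^2_\mathrm{MPL}(\mathfrak{g},\mathfrak{h},\rho,\psi)=\ker(\delta_\mathrm{MPL}:C^2\to C^3)/\mathrm{im}(\delta_\mathrm{MPL}:C^1\to C^2)$; note $C^1=\mathrm{Hom}(\mathfrak{g},\mathfrak{g})\oplus\mathrm{Hom}(\mathfrak{h},\mathfrak{h})$. *)

theory Defs
  imports
    "HOL-Analysis.Product_Vector"
    "HOL-Combinatorics.Permutations"
    "HOL-Computational_Algebra.Polynomial"
begin

section \<open>Bilinear maps, Lie algebras and matched pairs over a commutative ring\<close>

definition bilinear_map ::
  "('r::comm_ring_1 \<Rightarrow> 'a::ab_group_add \<Rightarrow> 'a) \<Rightarrow> ('r \<Rightarrow> 'b::ab_group_add \<Rightarrow> 'b) \<Rightarrow>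
   ('r \<Rightarrow> 'c::ab_group_add \<Rightarrow> 'c) \<Rightarrow> ('a \<Rightarrow> 'b \<Rightarrow> 'c) \<Rightarrow> bool"
  where "bilinear_map s1 s2 s3 B \<longleftrightarrow>
    (\<forall>x. module_hom s2 s3 (B x)) \<and> (\<forall>y. module_hom s1 s3 (\<lambda>x. B x y))"

definition skew_symmetric :: "('a \<Rightarrow> 'a \<Rightarrow> 'b::ab_group_add) \<Rightarrow> bool"
  where "skew_symmetric B \<longleftrightarrow> (\<forall>x y. B x y = - B y x)"

locale lie_algebra = module scale
  for scale :: "'r::comm_ring_1 \<Rightarrow> 'a::ab_group_add \<Rightarrow> 'a" +
  fixes br :: "'a \<Rightarrow> 'a \<Rightarrow> 'a"
  assumes br_bilinear: "bilinear_map scale scale scale br"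
    and br_alternating: "br x x = 0"
    and br_jacobi: "br x (br y z) + br y (br z x) + br z (br x y) = 0"

locale lie_representation = L: lie_algebra s1 br + V: module s2
  for s1 :: "'r::comm_ring_1 \<Rightarrow> 'a::ab_group_add \<Rightarrow> 'a"
    and br :: "'a \<Rightarrow> 'a \<Rightarrow> 'a"
    and s2 :: "'r \<Rightarrow> 'b::ab_group_add \<Rightarrow> 'b" +
  fixes \<rho> :: "'a \<Rightarrow> 'b \<Rightarrow> 'b"
  assumes rep_bilinear: "bilinear_map s1 s2 s2 \<rho>"
    and rep_br: "\<rho> (br x y) v = \<rho> x (\<rho> y v) - \<rho> y (\<rho> x v)"

locale matched_pair =
  G: lie_representation sg brg sh \<rho> + H: lie_representation sh brh sg \<psi>
  for sg :: "'r::comm_ring_1 \<Rightarrow> 'g::ab_group_add \<Rightarrow> 'g"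
    and sh :: "'r \<Rightarrow> 'h::ab_group_add \<Rightarrow> 'h"
    and brg :: "'g \<Rightarrow> 'g \<Rightarrow> 'g" and brh :: "'h \<Rightarrow> 'h \<Rightarrow> 'h"
    and \<rho> :: "'g \<Rightarrow> 'h \<Rightarrow> 'h" and \<psi> :: "'h \<Rightarrow> 'g \<Rightarrow> 'g" +
  assumes compat_h:
      "\<rho> x (brh h k) = brh (\<rho> x h) k + brh h (\<rho> x k) + \<rho> (\<psi> k x) h - \<rho> (\<psi> h x) k"
    and compat_g:
      "\<psi> h (brg x y) = brg (\<psi> h x) y + brg x (\<psi> h y) + \<psi> (\<rho> y h) x - \<psi> (\<rho> x h) y"

definition lie_hom ::
  "('r::comm_ring_1 \<Rightarrow> 'a::ab_group_add \<Rightarrow> 'a) \<Rightarrow> ('a \<Rightarrow> 'a \<Rightarrow> 'a) \<Rightarrow>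
   ('r \<Rightarrow> 'b::ab_group_add \<Rightarrow> 'b) \<Rightarrow> ('b \<Rightarrow> 'b \<Rightarrow> 'b) \<Rightarrow> ('a \<Rightarrow> 'b) \<Rightarrow> bool"
  where "lie_hom s1 br1 s2 br2 f \<longleftrightarrow>
    module_hom s1 s2 f \<and> (\<forall>x y. f (br1 x y) = br2 (f x) (f y))"

text \<open>A matched pair is passed as the tuple of its structure maps
  \<open>(brg, brh, \<rho>, \<psi>)\<close>; the scalar multiplications are given separately.\<close>

type_synonym ('g, 'h) structure_maps =
  "('g \<Rightarrow> 'g \<Rightarrow> 'g) \<times> ('h \<Rightarrow> 'h \<Rightarrow> 'h) \<times> ('g \<Rightarrow> 'h \<Rightarrow> 'h) \<times> ('h \<Rightarrow> 'g \<Rightarrow> 'g)"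

fun matched_pair_hom ::
  "('r::comm_ring_1 \<Rightarrow> 'g::ab_group_add \<Rightarrow> 'g) \<Rightarrow> ('r \<Rightarrow> 'h::ab_group_add \<Rightarrow> 'h) \<Rightarrow>
   ('g, 'h) structure_maps \<Rightarrow>
   ('r \<Rightarrow> 'g2::ab_group_add \<Rightarrow> 'g2) \<Rightarrow> ('r \<Rightarrow> 'h2::ab_group_add \<Rightarrow> 'h2) \<Rightarrow>
   ('g2, 'h2) structure_maps \<Rightarrow>
   ('g \<Rightarrow> 'g2) \<Rightarrow> ('h \<Rightarrow> 'h2) \<Rightarrow> bool"
  where "matched_pair_hom sg sh (brg, brh, \<rho>, \<psi>) sg' sh' (brg', brh', \<rho>', \<psi>') f g \<longleftrightarrow>
    lie_hom sg brg sg' brg' f \<and> lie_hom sh brh sh' brh' g \<and>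
    (\<forall>x h. g (\<rho> x h) = \<rho>' (f x) (g h)) \<and> (\<forall>h x. f (\<psi> h x) = \<psi>' (g h) (f x))"


section \<open>Truncated polynomials\<close>

text \<open>\<open>Trunc x y\<close> is the class of \<open>x + t y\<close> modulo \<open>t\<^sup>2\<close>. For a commutative ring
  \<open>'a\<close> the type \<open>'a trunc\<close> is the ring \<open>'a[t]/(t\<^sup>2)\<close>; for a module \<open>'a\<close> it is the
  underlying group of the module \<open>'a[t]/(t\<^sup>2)\<close>, with scalar multiplication \<open>trunc_scale\<close>.\<close>

datatype 'a trunc = Trunc (coeff0: 'a) (coeff1: 'a)

instantiation trunc :: (ab_group_add) ab_group_add
begin
definition "0 = Trunc 0 0"
definition "u + v = Trunc (coeff0 u + coeff0 v) (coeff1 u + coeff1 v)"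
definition "u - v = Trunc (coeff0 u - coeff0 v) (coeff1 u - coeff1 v)"
definition "- u = Trunc (- coeff0 u) (- coeff1 u)"
instance
  by standard
    (simp_all add: zero_trunc_def plus_trunc_def minus_trunc_def uminus_trunc_def
      algebra_simps)
end

instantiation trunc :: (comm_ring_1) comm_ring_1
begin
definition "1 = Trunc 1 0"
definition "u * v = Trunc (coeff0 u * coeff0 v) (coeff0 u * coeff1 v + coeff1 u * coeff0 v)"
instance
  by standard
    (simp_all add: zero_trunc_def plus_trunc_def one_trunc_def times_trunc_def algebra_simps)
end

definition trunc_scale ::
  "('r::comm_ring_1 \<Rightarrow> 'a::ab_group_add \<Rightarrow> 'a) \<Rightarrow> 'r trunc \<Rightarrow> 'a trunc \<Rightarrow> 'a trunc"
  where "trunc_scale s c u =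
    Trunc (s (coeff0 c) (coeff0 u)) (s (coeff0 c) (coeff1 u) + s (coeff1 c) (coeff0 u))"

text \<open>The bilinear extension of \<open>(x, y) \<mapsto> B0 x y + t B1 x y\<close>.\<close>

definition trunc_bilinear ::
  "('a \<Rightarrow> 'b \<Rightarrow> 'c::ab_group_add) \<Rightarrow> ('a \<Rightarrow> 'b \<Rightarrow> 'c) \<Rightarrow> 'a trunc \<Rightarrow> 'b trunc \<Rightarrow> 'c trunc"
  where "trunc_bilinear B0 B1 u v =
    Trunc (B0 (coeff0 u) (coeff0 v))
      (B0 (coeff0 u) (coeff1 v) + B0 (coeff1 u) (coeff0 v) + B1 (coeff0 u) (coeff0 v))"

text \<open>The linear extension of \<open>x \<mapsto> x + t f x\<close>.\<close>

definition id_plus_t :: "('a \<Rightarrow> 'a::ab_group_add) \<Rightarrow> 'a trunc \<Rightarrow> 'a trunc"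
  where "id_plus_t f u = Trunc (coeff0 u) (coeff1 u + f (coeff0 u))"

lemma poly_to_trunc_quotient:
  fixes \<phi> :: "'a::comm_ring_1 poly \<Rightarrow> 'a trunc"
  defines "\<phi> \<equiv> \<lambda>p. Trunc (coeff p 0) (coeff p 1)"
  shows "\<phi> 1 = 1" "\<phi> (p + q) = \<phi> p + \<phi> q" "\<phi> (p * q) = \<phi> p * \<phi> q" "surj \<phi>"
    "\<phi> p = 0 \<longleftrightarrow> monom 1 2 dvd p"
proof -
  show "\<phi> 1 = 1" "\<phi> (p + q) = \<phi> p + \<phi> q"
    by (simp_all add: \<phi>_def one_trunc_def plus_trunc_def)
  show "\<phi> (p * q) = \<phi> p * \<phi> q"
    by (simp add: \<phi>_def times_trunc_def coeff_mult)
  show "surj \<phi>"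
    unfolding surj_def
  proof
    fix u :: "'a trunc"
    show "\<exists>p. u = \<phi> p"
      by (rule exI[of _ "[:coeff0 u, coeff1 u:]"]) (simp add: \<phi>_def)
  qed
  show "\<phi> p = 0 \<longleftrightarrow> monom 1 2 dvd p"
    by (auto simp: \<phi>_def zero_trunc_def monom_1_dvd_iff' less_2_cases_iff)
qed

lemma module_trunc_scale: "module s \<Longrightarrow> module (trunc_scale s)"
  unfolding module_def trunc_scale_def
  by (simp add: plus_trunc_def times_trunc_def one_trunc_def module.scale_zero_left
      module_def algebra_simps)

lemma trunc_bilinear_unique:
  assumes "bilinear_map (trunc_scale s1) (trunc_scale s2) (trunc_scale s3) B"
    and "module s1" "module s2" "module s3"
    and B: "\<And>x y. B (Trunc x 0) (Trunc y 0) = Trunc (B0 x y) (B1 x y)"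
  shows "B = trunc_bilinear B0 B1"
proof (intro ext)
  fix u v
  interpret s1: module s1 by fact
  interpret s2: module s2 by fact
  interpret s3: module s3 by fact
  let ?t = "Trunc 0 1"
  have split1: "w = Trunc (coeff0 w) 0 + trunc_scale s1 ?t (Trunc (coeff1 w) 0)" for w
    by (simp add: trunc_scale_def plus_trunc_def)
  have split2: "w = Trunc (coeff0 w) 0 + trunc_scale s2 ?t (Trunc (coeff1 w) 0)" for w
    by (simp add: trunc_scale_def plus_trunc_def)
  have l: "module_hom (trunc_scale s1) (trunc_scale s3) (\<lambda>x. B x y)"
    and r: "module_hom (trunc_scale s2) (trunc_scale s3) (B x)" for x y
    using assms(1) by (auto simp: bilinear_map_def)
  have "B u v = B (Trunc (coeff0 u) 0) v + trunc_scale s3 ?t (B (Trunc (coeff1 u) 0) v)"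
    by (subst split1[of u]) (simp add: module_hom.add[OF l] module_hom.scale[OF l])
  moreover have "B w v = B w (Trunc (coeff0 v) 0) + trunc_scale s3 ?t (B w (Trunc (coeff1 v) 0))"
    for w
    by (subst split2[of v]) (simp add: module_hom.add[OF r] module_hom.scale[OF r])
  ultimately show "B u v = trunc_bilinear B0 B1 u v"
    by (simp add: B trunc_scale_def trunc_bilinear_def plus_trunc_def algebra_simps)
qed

lemma id_plus_t_unique:
  assumes "module_hom (trunc_scale s) (trunc_scale s) F" "module s"
    and F: "\<And>x. F (Trunc x 0) = Trunc x (f x)"
  shows "F = id_plus_t f"
proof
  fix u
  interpret module s by fact
  have "u = Trunc (coeff0 u) 0 + trunc_scale s (Trunc 0 1) (Trunc (coeff1 u) 0)"
    by (simp add: trunc_scale_def plus_trunc_def)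
  then have "F u = F (Trunc (coeff0 u) 0) + trunc_scale s (Trunc 0 1) (F (Trunc (coeff1 u) 0))"
    by (metis assms(1) module_hom.add module_hom.scale)
  then show "F u = id_plus_t f u"
    by (simp add: F trunc_scale_def id_plus_t_def plus_trunc_def algebra_simps)
qed


section \<open>Infinitesimal deformations\<close>

fun deformed ::
  "('g::ab_group_add, 'h::ab_group_add) structure_maps \<Rightarrow> ('g, 'h) structure_maps \<Rightarrow>
   ('g trunc, 'h trunc) structure_maps"
  where "deformed (brg, brh, \<rho>, \<psi>) (\<mu>1, \<nu>1, \<rho>1, \<psi>1) =
    (trunc_bilinear brg \<mu>1, trunc_bilinear brh \<nu>1,
     trunc_bilinear \<rho> \<rho>1, trunc_bilinear \<psi> \<psi>1)"

definition infinitesimal_deformations ::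
  "('k::field \<Rightarrow> 'g::ab_group_add \<Rightarrow> 'g) \<Rightarrow> ('k \<Rightarrow> 'h::ab_group_add \<Rightarrow> 'h) \<Rightarrow>
   ('g, 'h) structure_maps \<Rightarrow> ('g, 'h) structure_maps set"
  where "infinitesimal_deformations sg sh M =
    {(\<mu>1, \<nu>1, \<rho>1, \<psi>1).
      bilinear_map sg sg sg \<mu>1 \<and> skew_symmetric \<mu>1 \<and>
      bilinear_map sh sh sh \<nu>1 \<and> skew_symmetric \<nu>1 \<and>
      bilinear_map sg sh sh \<rho>1 \<and> bilinear_map sh sg sg \<psi>1 \<and>
      (case deformed M (\<mu>1, \<nu>1, \<rho>1, \<psi>1) of (\<mu>t, \<nu>t, \<rho>t, \<psi>t) \<Rightarrow>
        matched_pair (trunc_scale sg) (trunc_scale sh) \<mu>t \<nu>t \<rho>t \<psi>t)}"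

definition equivalent_deformations ::
  "('k::field \<Rightarrow> 'g::ab_group_add \<Rightarrow> 'g) \<Rightarrow> ('k \<Rightarrow> 'h::ab_group_add \<Rightarrow> 'h) \<Rightarrow>
   ('g, 'h) structure_maps \<Rightarrow> (('g, 'h) structure_maps \<times> ('g, 'h) structure_maps) set"
  where "equivalent_deformations sg sh M =
    {(D, D').
      D \<in> infinitesimal_deformations sg sh M \<and> D' \<in> infinitesimal_deformations sg sh M \<and>
      (\<exists>f g. Vector_Spaces.linear sg sg f \<and> Vector_Spaces.linear sh sh g \<and>
        matched_pair_hom (trunc_scale sg) (trunc_scale sh) (deformed M D)
          (trunc_scale sg) (trunc_scale sh) (deformed M D') (id_plus_t f) (id_plus_t g))}"


section \<open>The Nijenhuis--Richardson bracket\<close>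

text \<open>An \<open>n\<close>-ary map is a function of a sequence \<open>z\<close> that reads only
  \<open>z 0, \<dots>, z (n - 1)\<close>, so that equality of \<open>n\<close>-ary maps is equality of functions.
  Arguments and shuffles are numbered from \<open>0\<close>; \<open>unshuffles p q\<close> is \<open>Sh(p, q)\<close>.\<close>

definition multilinear ::
  "('k::field \<Rightarrow> 'e::ab_group_add \<Rightarrow> 'e) \<Rightarrow> nat \<Rightarrow> ((nat \<Rightarrow> 'e) \<Rightarrow> 'e) \<Rightarrow> bool"
  where "multilinear s n F \<longleftrightarrow>
    (\<forall>z z'. (\<forall>i<n. z i = z' i) \<longrightarrow> F z = F z') \<and>
    (\<forall>i<n. \<forall>z. Vector_Spaces.linear s s (\<lambda>v. F (z(i := v))))"

definition skew_multilinear ::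
  "('k::field \<Rightarrow> 'e::ab_group_add \<Rightarrow> 'e) \<Rightarrow> nat \<Rightarrow> ((nat \<Rightarrow> 'e) \<Rightarrow> 'e) \<Rightarrow> bool"
  where "skew_multilinear s n F \<longleftrightarrow> multilinear s n F \<and>
    (\<forall>\<sigma> z. \<sigma> permutes {..<n} \<longrightarrow> F (\<lambda>i. z (\<sigma> i)) = s (of_int (sign \<sigma>)) (F z))"

definition unshuffles :: "nat \<Rightarrow> nat \<Rightarrow> (nat \<Rightarrow> nat) set"
  where "unshuffles p q =
    {\<sigma>. \<sigma> permutes {..<p + q} \<and> strict_mono_on {..<p} \<sigma> \<and> strict_mono_on {p..<p + q} \<sigma>}"

text \<open>\<open>nr_insert s m n f g\<close> is \<open>i\<^sub>f g\<close> for \<open>f\<close> of arity \<open>m + 1\<close> and \<open>g\<close> of arity \<open>n + 1\<close>.\<close>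

definition nr_insert ::
  "('k::field \<Rightarrow> 'e::ab_group_add \<Rightarrow> 'e) \<Rightarrow> nat \<Rightarrow> nat \<Rightarrow>
   ((nat \<Rightarrow> 'e) \<Rightarrow> 'e) \<Rightarrow> ((nat \<Rightarrow> 'e) \<Rightarrow> 'e) \<Rightarrow> (nat \<Rightarrow> 'e) \<Rightarrow> 'e"
  where "nr_insert s m n f g z =
    (\<Sum>\<sigma>\<in>unshuffles (m + 1) n. s (of_int (sign \<sigma>))
      (g (\<lambda>i. if i = 0 then f (\<lambda>j. z (\<sigma> j)) else z (\<sigma> (m + i)))))"

definition nr_bracket ::
  "('k::field \<Rightarrow> 'e::ab_group_add \<Rightarrow> 'e) \<Rightarrow> nat \<Rightarrow> nat \<Rightarrow>
   ((nat \<Rightarrow> 'e) \<Rightarrow> 'e) \<Rightarrow> ((nat \<Rightarrow> 'e) \<Rightarrow> 'e) \<Rightarrow> (nat \<Rightarrow> 'e) \<Rightarrow> 'e"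
  where "nr_bracket s m n f g z =
    nr_insert s m n f g z - s ((- 1) ^ (m * n)) (nr_insert s n m g f z)"


section \<open>Cohomology of a matched pair\<close>

text \<open>The arguments \<open>(x\<^sub>0, 0), \<dots>, (x\<^sub>a\<^sub>-\<^sub>1, 0), (0, h\<^sub>0), (0, h\<^sub>1), \<dots>\<close>
  run through the generators of \<open>\<And>\<^sup>a\<gg> \<otimes> \<And>\<^sup>b\<hh>\<close> inside \<open>\<And>\<^sup>a\<^sup>+\<^sup>b(\<gg> \<oplus> \<hh>)\<close>.\<close>

definition mixed_args ::
  "nat \<Rightarrow> (nat \<Rightarrow> 'g) \<Rightarrow> (nat \<Rightarrow> 'h) \<Rightarrow> nat \<Rightarrow> 'g::ab_group_add \<times> 'h::ab_group_add"
  where "mixed_args a x h i = (if i < a then (x i, 0) else (0, h (i - a)))"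

definition bidegree_cochains ::
  "('k::field \<Rightarrow> 'g::ab_group_add \<Rightarrow> 'g) \<Rightarrow> ('k \<Rightarrow> 'h::ab_group_add \<Rightarrow> 'h) \<Rightarrow>
   nat \<Rightarrow> nat \<Rightarrow> ((nat \<Rightarrow> 'g \<times> 'h) \<Rightarrow> 'g \<times> 'h) set"
  where "bidegree_cochains sg sh k l =
    {F. skew_multilinear (module_prod.scale sg sh) (k + l + 1) F \<and>
      (\<forall>x h. F (mixed_args (k + 1) x h) \<in> UNIV \<times> {0}) \<and>
      (\<forall>x h. F (mixed_args k x h) \<in> {0} \<times> UNIV) \<and>
      (\<forall>a \<le> k + l + 1. a \<noteq> k + 1 \<and> a \<noteq> k \<longrightarrow> (\<forall>x h. F (mixed_args a x h) = 0))}"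

definition mpl_cochains ::
  "('k::field \<Rightarrow> 'g::ab_group_add \<Rightarrow> 'g) \<Rightarrow> ('k \<Rightarrow> 'h::ab_group_add \<Rightarrow> 'h) \<Rightarrow>
   nat \<Rightarrow> ((nat \<Rightarrow> 'g \<times> 'h) \<Rightarrow> 'g \<times> 'h) set"
  where "mpl_cochains sg sh n =
    {\<lambda>z. \<Sum>l<n. G l z |G. \<forall>l<n. G l \<in> bidegree_cochains sg sh (n - 1 - l) l}"

fun mpl_pi ::
  "('g::ab_group_add, 'h::ab_group_add) structure_maps \<Rightarrow> (nat \<Rightarrow> 'g \<times> 'h) \<Rightarrow> 'g \<times> 'h"
  where "mpl_pi (brg, brh, \<rho>, \<psi>) z =
    (case (z 0, z 1) of ((x, h), (y, k)) \<Rightarrow>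
      (brg x y + \<psi> h y - \<psi> k x, brh h k + \<rho> x k - \<rho> y h))"

text \<open>\<open>mpl_delta sg sh M n\<close> is the differential on \<open>n\<close>-cochains, for \<open>n \<ge> 1\<close>; these have
  arity \<open>n\<close>, hence Nijenhuis--Richardson degree \<open>n - 1\<close>.\<close>

definition mpl_delta ::
  "('k::field \<Rightarrow> 'g::ab_group_add \<Rightarrow> 'g) \<Rightarrow> ('k \<Rightarrow> 'h::ab_group_add \<Rightarrow> 'h) \<Rightarrow>
   ('g, 'h) structure_maps \<Rightarrow> nat \<Rightarrow>
   ((nat \<Rightarrow> 'g \<times> 'h) \<Rightarrow> 'g \<times> 'h) \<Rightarrow> (nat \<Rightarrow> 'g \<times> 'h) \<Rightarrow> 'g \<times> 'h"
  where "mpl_delta sg sh M n F z =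
    - nr_bracket (module_prod.scale sg sh) 1 (n - 1) (mpl_pi M) F z"

definition mpl_cocycles ::
  "('k::field \<Rightarrow> 'g::ab_group_add \<Rightarrow> 'g) \<Rightarrow> ('k \<Rightarrow> 'h::ab_group_add \<Rightarrow> 'h) \<Rightarrow>
   ('g, 'h) structure_maps \<Rightarrow> nat \<Rightarrow> ((nat \<Rightarrow> 'g \<times> 'h) \<Rightarrow> 'g \<times> 'h) set"
  where "mpl_cocycles sg sh M n =
    {F \<in> mpl_cochains sg sh n. mpl_delta sg sh M n F = (\<lambda>z. 0)}"

definition mpl_coboundaries ::
  "('k::field \<Rightarrow> 'g::ab_group_add \<Rightarrow> 'g) \<Rightarrow> ('k \<Rightarrow> 'h::ab_group_add \<Rightarrow> 'h) \<Rightarrow>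
   ('g, 'h) structure_maps \<Rightarrow> nat \<Rightarrow> ((nat \<Rightarrow> 'g \<times> 'h) \<Rightarrow> 'g \<times> 'h) set"
  where "mpl_coboundaries sg sh M n = mpl_delta sg sh M (n - 1) ` mpl_cochains sg sh (n - 1)"

text \<open>The underlying set of the quotient space (cosets), for \<open>n \<ge> 2\<close>.\<close>

definition mpl_cohomology ::
  "('k::field \<Rightarrow> 'g::ab_group_add \<Rightarrow> 'g) \<Rightarrow> ('k \<Rightarrow> 'h::ab_group_add \<Rightarrow> 'h) \<Rightarrow>
   ('g, 'h) structure_maps \<Rightarrow> nat \<Rightarrow> ((nat \<Rightarrow> 'g \<times> 'h) \<Rightarrow> 'g \<times> 'h) set set"
  where "mpl_cohomology sg sh M n =
    mpl_cocycles sg sh M n //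
      {(F, F'). F \<in> mpl_cocycles sg sh M n \<and> F' \<in> mpl_cocycles sg sh M n \<and>
        (\<lambda>z. F z - F' z) \<in> mpl_coboundaries sg sh M n}"

end

theory Submission
  imports Defs
begin

text \<open>
  On \<open>\<gg> \<oplus> \<hh>\<close> put the bracket \<open>\<pi>\<close> of the bicrossed sum. For bilinear data with alternating
  brackets, being a matched pair (over any commutative ring) is the Jacobi identity for \<open>\<pi>\<close>, and a
  pair of linear maps \<open>(f, g)\<close> is a morphism iff \<open>f \<times> g\<close> preserves these brackets. A quadruple \<open>D\<close> of
  first-order terms has a bicrossed bracket \<open>F\<^sub>D\<close> of its own, and \<open>D \<mapsto> F\<^sub>D\<close> identifies quadruples
  with 2-cochains. Over \<open>k[t]/(t\<^sup>2)\<close> the \<open>t\<close>-coefficient of the Jacobi identity for \<open>\<pi> + t F\<^sub>D\<close> is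
  the cocycle condition for \<open>F\<^sub>D\<close>, and the \<open>t\<close>-coefficient of the morphism condition for
  \<open>id + t (f \<times> g)\<close> reads \<open>F\<^sub>D - F\<^sub>D\<^sub>' = \<delta>(f \<times> g)\<close>. So the bijection of deformations with
  cocycles matches the two relations and descends to the quotients.
\<close>

section \<open>Bijections of quotients and generalities on bilinear maps\<close>

lemma bij_betw_quotient:
  assumes "bij_betw f A B" and "R \<subseteq> A \<times> A" and "S \<subseteq> B \<times> B"
    and RS: "\<And>x y. x \<in> A \<Longrightarrow> y \<in> A \<Longrightarrow> (x, y) \<in> R \<longleftrightarrow> (f x, f y) \<in> S"
  shows "bij_betw ((`) f) (A // R) (B // S)"
proof (rule bij_betwI')
  have inj: "inj_on f A"
    using assms(1) by (auto simp: bij_betw_def)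
  fix X Y assume "X \<in> A // R" "Y \<in> A // R"
  moreover have "Z \<subseteq> A" if "Z \<in> A // R" for Z
    using that assms(2) by (auto simp: quotient_def)
  ultimately show "f ` X = f ` Y \<longleftrightarrow> X = Y"
    using inj by (simp add: inj_on_image_eq_iff)
next
  have B: "B = f ` A"
    using assms(1) by (auto simp: bij_betw_def)
  \<comment> \<open>The relations are arbitrary, so classes are just images of points. Everything
    \<open>S\<close>-related to \<open>f x\<close> lies in \<open>B\<close>, hence is some
    \<open>f y\<close>, and \<open>RS\<close> puts \<open>y\<close> in the class of
    \<open>x\<close>.\<close>
  have cls: "f ` (R `` {x}) = S `` {f x}" if "x \<in> A" for x
    using assms(2,3) RS that unfolding B by auto
  show "f ` X \<in> B // S" if "X \<in> A // R" for X
    using that cls unfolding B quotient_def by auto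
  show "\<exists>X\<in>A // R. Y = f ` X" if "Y \<in> B // S" for Y
    using that cls unfolding B quotient_def by auto
qed

lemma neq_funI: "f x \<noteq> g x \<Longrightarrow> f \<noteq> g"
  by auto

lemma bilinear_map_simps:
  assumes "bilinear_map s1 s2 s3 B"
  shows "B (x + y) z = B x z + B y z" "B x (v + w) = B x v + B x w"
    "B (x - y) z = B x z - B y z" "B x (v - w) = B x v - B x w"
    "B (- x) z = - B x z" "B x (- v) = - B x v" "B 0 z = 0" "B x 0 = 0"
    "B (s1 c x) z = s3 c (B x z)" "B x (s2 c v) = s3 c (B x v)"
proof -
  have r: "module_hom s2 s3 (B x)" and l: "module_hom s1 s3 (\<lambda>x. B x z)" for x z
    using assms by (auto simp: bilinear_map_def)
  interpret r: module_hom s2 s3 "B x" by (rule r)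
  interpret l: module_hom s1 s3 "\<lambda>x. B x z" by (rule l)
  show "B (x + y) z = B x z + B y z" "B x (v + w) = B x v + B x w"
    "B (x - y) z = B x z - B y z" "B x (v - w) = B x v - B x w"
    "B (- x) z = - B x z" "B x (- v) = - B x v" "B 0 z = 0" "B x 0 = 0"
    "B (s1 c x) z = s3 c (B x z)" "B x (s2 c v) = s3 c (B x v)"
    by (rule l.add r.add l.diff r.diff l.neg r.neg l.zero r.zero l.scale r.scale)+
qed

lemma bilinear_mapI:
  assumes "module s1" "module s2" "module s3"
    and "\<And>x y z. B (x + y) z = B x z + B y z" "\<And>x v w. B x (v + w) = B x v + B x w"
    and "\<And>c x z. B (s1 c x) z = s3 c (B x z)" "\<And>c x v. B x (s2 c v) = s3 c (B x v)"
  shows "bilinear_map s1 s2 s3 B"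
  using assms by (simp add: bilinear_map_def module_hom_def module_hom_axioms_def)

text \<open>Polarization: expand \<open>B (x + y) (x + y) = 0\<close>. There is no division by 2, so
  this also serves over k[t]/(t^2).\<close>

lemma alternating_imp_skew:
  assumes "bilinear_map s s s3 B" and alt: "\<And>x. B x x = 0"
  shows "B x y = - B y x"
proof -
  have "B (x + y) (x + y) = B x y + B y x"
    unfolding bilinear_map_simps[OF assms(1)] by (simp add: alt)
  then show ?thesis
    by (simp add: alt eq_neg_iff_add_eq_0)
qed

text \<open>Characteristic zero enters here: 2 is invertible and \<open>s 2 x = x + x = 0\<close>.
  It turns skew-symmetry, which the definitions of deformations and cochains ask for, into the
  alternating law of \<open>bilinear_structure\<close>.\<close>

lemma self_negative_imp_zero:
  fixes s :: "'k::field_char_0 \<Rightarrow> 'b::ab_group_add \<Rightarrow> 'b" and x :: 'b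
  assumes "vector_space s" and "x = - x"
  shows "x = 0"
proof -
  interpret vector_space s by fact
  have "s 2 x = x + x"
    using scale_left_distrib[of 1 1 x] by simp
  also have "\<dots> = 0"
    using assms(2) by (simp add: eq_neg_iff_add_eq_0)
  finally show ?thesis by simp
qed

lemma trunc_bilinear_bilinear_map:
  assumes "bilinear_map s1 s2 s3 B0" "bilinear_map s1 s2 s3 B1" "module s1" "module s2" "module s3"
  shows "bilinear_map (trunc_scale s1) (trunc_scale s2) (trunc_scale s3) (trunc_bilinear B0 B1)"
proof -
  interpret s3: module s3 by fact
  show ?thesis
    by (intro bilinear_mapI module_trunc_scale assms(3-5))
       (simp_all add: trunc_bilinear_def trunc_scale_def plus_trunc_def
        bilinear_map_simps[OF assms(1)] bilinear_map_simps[OF assms(2)] algebra_simps)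
qed

section \<open>The bicrossed bracket\<close>

text \<open>The formula of \<open>mpl_pi\<close> as a function of two vectors. It is applied to the
  given structure maps, to first-order terms and to deformed structures over k[t]/(t^2).\<close>

fun bicrossed ::
  "('g::ab_group_add, 'h::ab_group_add) structure_maps \<Rightarrow> 'g \<times> 'h \<Rightarrow> 'g \<times> 'h \<Rightarrow> 'g \<times> 'h"
  where "bicrossed (brg, brh, \<rho>, \<psi>) (x, h) (y, k) =
    (brg x y + \<psi> h y - \<psi> k x, brh h k + \<rho> x k - \<rho> y h)"

lemma mpl_pi_eq_bicrossed: "mpl_pi M z = bicrossed M (z 0) (z 1)"
  by (cases M; cases "z 0"; cases "z 1") simp

text \<open>What the structure maps of a matched pair and quadruples of first-order terms have in
  common: bilinearity and alternating brackets, without the quadratic axioms. A commutative base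
  ring admits k[t]/(t^2).\<close>

locale bilinear_structure = g: module sg + h: module sh
  for sg :: "'r::comm_ring_1 \<Rightarrow> 'g::ab_group_add \<Rightarrow> 'g"
    and sh :: "'r \<Rightarrow> 'h::ab_group_add \<Rightarrow> 'h" +
  fixes brg :: "'g \<Rightarrow> 'g \<Rightarrow> 'g" and brh :: "'h \<Rightarrow> 'h \<Rightarrow> 'h"
    and \<rho> :: "'g \<Rightarrow> 'h \<Rightarrow> 'h" and \<psi> :: "'h \<Rightarrow> 'g \<Rightarrow> 'g"
  assumes bilinear: "bilinear_map sg sg sg brg" "bilinear_map sh sh sh brh"
      "bilinear_map sg sh sh \<rho>" "bilinear_map sh sg sg \<psi>"
    and alternating: "brg x x = 0" "brh h h = 0"
begin

abbreviation "\<pi> \<equiv> bicrossed (brg, brh, \<rho>, \<psi>)"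

lemmas maps_simps = bilinear[THEN bilinear_map_simps(1)] bilinear[THEN bilinear_map_simps(2)]
  bilinear[THEN bilinear_map_simps(3)] bilinear[THEN bilinear_map_simps(4)]
  bilinear[THEN bilinear_map_simps(5)] bilinear[THEN bilinear_map_simps(6)]
  bilinear[THEN bilinear_map_simps(7)] bilinear[THEN bilinear_map_simps(8)]
  bilinear[THEN bilinear_map_simps(9)] bilinear[THEN bilinear_map_simps(10)]

lemmas skew_g = alternating_imp_skew[OF bilinear(1) alternating(1)]
  and skew_h = alternating_imp_skew[OF bilinear(2) alternating(2)]

sublocale gh: module_prod sg sh by unfold_locales

lemma bicrossed_bilinear: "bilinear_map gh.scale gh.scale gh.scale \<pi>"
  by (rule bilinear_mapI)
    (auto simp: maps_simps gh.scale_def gh.p.module_axioms algebra_simps)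

lemma bicrossed_alternating: "\<pi> u u = 0"
  by (cases u) (simp add: alternating zero_prod_def)

text \<open>Terms of the expansion with all three entries from one summand cancel by the Jacobi
  identity there. The mixed ones cancel once the representation laws have expanded actions by
  brackets and the compatibilities actions on brackets.\<close>

lemma matched_pair_imp_jacobi:
  assumes "matched_pair sg sh brg brh \<rho> \<psi>"
  shows "\<pi> u (\<pi> v w) + \<pi> v (\<pi> w u) + \<pi> w (\<pi> u v) = 0"
proof -
  interpret matched_pair sg sh brg brh \<rho> \<psi> by fact
  have J: "\<pi> (x, h) (\<pi> (y, k) (z, l)) + \<pi> (y, k) (\<pi> (z, l) (x, h))
    + \<pi> (z, l) (\<pi> (x, h) (y, k)) = 0" for x y z h k l
  proof -
    have 1: "brg x (brg y z) = - brg y (brg z x) - brg z (brg x y)"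
      using G.L.br_jacobi[of x y z] by (simp add: algebra_simps eq_neg_iff_add_eq_0)
    have 2: "brh h (brh k l) = - brh k (brh l h) - brh l (brh h k)"
      using H.L.br_jacobi[of h k l] by (simp add: algebra_simps eq_neg_iff_add_eq_0)
    \<comment> \<open>After the first pass, brackets with an action term as a factor occur in both
      orders; the second pass puts that factor second so that they cancel.\<close>
    show ?thesis
      by (simp add: zero_prod_def maps_simps G.rep_br H.rep_br compat_g compat_h 1 2)
         (simp add: skew_g[of "\<psi> _ _"] skew_h[of "\<rho> _ _"])
  qed
  show ?thesis using J by (metis surj_pair)
qed

text \<open>Each axiom is a component of the Jacobi identity at pure vectors. Three from one summand
  give the Jacobi identity there; two from \<gg> and one from \<hh> give the representation law of
  \<open>\<rho>\<close> in the \<hh> component and \<open>compat_g\<close> in the \<gg> component,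
  and symmetrically for two from \<hh>.\<close>

lemma jacobi_imp_matched_pair:
  assumes J: "\<And>u v w. \<pi> u (\<pi> v w) + \<pi> v (\<pi> w u) + \<pi> w (\<pi> u v) = 0"
  shows "matched_pair sg sh brg brh \<rho> \<psi>"
proof unfold_locales
  note s = zero_prod_def maps_simps
  fix x y z :: 'g and h k l :: 'h
  show "bilinear_map sg sg sg brg" "bilinear_map sh sh sh brh"
    "bilinear_map sg sh sh \<rho>" "bilinear_map sh sg sg \<psi>" "brg x x = 0" "brh h h = 0"
    by (fact bilinear alternating)+
  show "brg x (brg y z) + brg y (brg z x) + brg z (brg x y) = 0"
    using J[of "(x, 0)" "(y, 0)" "(z, 0)"] by (simp add: s)
  show "brh h (brh k l) + brh k (brh l h) + brh l (brh h k) = 0"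
    using J[of "(0, h)" "(0, k)" "(0, l)"] by (simp add: s)
  show "\<rho> (brg x y) h = \<rho> x (\<rho> y h) - \<rho> y (\<rho> x h)"
    using J[of "(x, 0)" "(y, 0)" "(0, h)"] by (simp add: s algebra_simps)
  show "\<psi> (brh h k) x = \<psi> h (\<psi> k x) - \<psi> k (\<psi> h x)"
    using J[of "(0, h)" "(0, k)" "(x, 0)"] by (simp add: s algebra_simps)
  show "\<rho> x (brh h k) = brh (\<rho> x h) k + brh h (\<rho> x k) + \<rho> (\<psi> k x) h - \<rho> (\<psi> h x) k"
    using J[of "(x, 0)" "(0, h)" "(0, k)"] skew_h[of k "\<rho> x h"] by (simp add: s algebra_simps)
  show "\<psi> h (brg x y) = brg (\<psi> h x) y + brg x (\<psi> h y) + \<psi> (\<rho> y h) x - \<psi> (\<rho> x h) y"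
    using J[of "(0, h)" "(x, 0)" "(y, 0)"] skew_g[of y "\<psi> h x"] by (simp add: s algebra_simps)
qed

end

definition bilinear_structures ::
  "('r::comm_ring_1 \<Rightarrow> 'g::ab_group_add \<Rightarrow> 'g) \<Rightarrow> ('r \<Rightarrow> 'h::ab_group_add \<Rightarrow> 'h) \<Rightarrow>
   ('g, 'h) structure_maps set"
  where "bilinear_structures sg sh = {(brg, brh, \<rho>, \<psi>). bilinear_structure sg sh brg brh \<rho> \<psi>}"

lemma bilinear_structuresD:
  assumes "M \<in> bilinear_structures sg sh"
  shows "module_prod sg sh" "bicrossed M u u = 0"
    "bilinear_map (module_prod.scale sg sh) (module_prod.scale sg sh) (module_prod.scale sg sh)
      (bicrossed M)"
proof -
  obtain brg brh \<rho> \<psi> where M: "M = (brg, brh, \<rho>, \<psi>)" by (cases M)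
  with assms interpret bilinear_structure sg sh brg brh \<rho> \<psi>
    by (simp add: bilinear_structures_def)
  show "module_prod sg sh" "bicrossed M u u = 0"
    "bilinear_map gh.scale gh.scale gh.scale (bicrossed M)"
    by (simp_all add: M gh.module_prod_axioms bicrossed_alternating bicrossed_bilinear)
qed

lemma matched_pair_bilinear_structures:
  assumes "matched_pair sg sh brg brh \<rho> \<psi>"
  shows "(brg, brh, \<rho>, \<psi>) \<in> bilinear_structures sg sh"
proof -
  interpret matched_pair sg sh brg brh \<rho> \<psi> by fact
  show ?thesis
    unfolding bilinear_structures_def mem_Collect_eq prod.case
    by unfold_locales (fact G.L.br_bilinear H.L.br_bilinear G.rep_bilinear H.rep_bilinear
        G.L.br_alternating H.L.br_alternating)+
qed

lemma matched_pair_iff_jacobi: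
  assumes "(brg, brh, \<rho>, \<psi>) \<in> bilinear_structures sg sh"
  defines "\<pi> \<equiv> bicrossed (brg, brh, \<rho>, \<psi>)"
  shows "matched_pair sg sh brg brh \<rho> \<psi> \<longleftrightarrow>
    (\<forall>u v w. \<pi> u (\<pi> v w) + \<pi> v (\<pi> w u) + \<pi> w (\<pi> u v) = 0)"
proof -
  interpret bilinear_structure sg sh brg brh \<rho> \<psi>
    using assms(1) by (simp add: bilinear_structures_def)
  show ?thesis
    unfolding \<pi>_def using matched_pair_imp_jacobi jacobi_imp_matched_pair by blast
qed

lemma bicrossed_skew:
  assumes "M \<in> bilinear_structures sg sh"
  shows "bicrossed M u v = - bicrossed M v u"
  by (rule alternating_imp_skew[OF bilinear_structuresD(3)[OF assms] bilinear_structuresD(2)[OF assms]])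

lemmas bicrossed_simps = bilinear_map_simps[OF bilinear_structuresD(3)]

text \<open>The bracket on pure vectors determines the four maps; its value
  \<open>(- \<psi> h x, \<rho> x h)\<close> at \<open>(x, 0)\<close>, \<open>(0, h)\<close> gives
  both actions.\<close>

lemma bicrossed_inject:
  assumes "M \<in> bilinear_structures sg sh" "N \<in> bilinear_structures sg sh"
    and "bicrossed M = bicrossed N"
  shows "M = N"
proof -
  obtain brg brh \<rho> \<psi> where M: "M = (brg, brh, \<rho>, \<psi>)" by (cases M)
  obtain brg' brh' \<rho>' \<psi>' where N: "N = (brg', brh', \<rho>', \<psi>')" by (cases N)
  interpret M: bilinear_structure sg sh brg brh \<rho> \<psi>
    using assms(1) by (simp add: M bilinear_structures_def)
  interpret N: bilinear_structure sg sh brg' brh' \<rho>' \<psi>'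
    using assms(2) by (simp add: N bilinear_structures_def)
  note e = assms(3)[unfolded M N, THEN fun_cong, THEN fun_cong]
  have "brg x y = brg' x y" "brh h k = brh' h k" "\<rho> x h = \<rho>' x h" "\<psi> h x = \<psi>' h x" for x y h k
    using e[of "(x, 0)" "(y, 0)"] e[of "(0, h)" "(0, k)"] e[of "(x, 0)" "(0, h)"]
    by (simp_all add: M.maps_simps N.maps_simps)
  then show ?thesis by (simp add: M N fun_eq_iff)
qed

section \<open>The deformed bracket\<close>

text \<open>A pair of truncated polynomials is read as a truncated polynomial over \<gg> \<oplus>
  \<hh>, with \<open>pair_coeff1\<close> for its \<open>t\<close>-coefficient.\<close>

definition pair_coeff0 :: "'g trunc \<times> 'h trunc \<Rightarrow> 'g \<times> 'h"
  where "pair_coeff0 u = (coeff0 (fst u), coeff0 (snd u))"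

definition pair_coeff1 :: "'g trunc \<times> 'h trunc \<Rightarrow> 'g \<times> 'h"
  where "pair_coeff1 u = (coeff1 (fst u), coeff1 (snd u))"

lemma pair_trunc_eq_iff:
  "u = v \<longleftrightarrow> pair_coeff0 u = pair_coeff0 v \<and> pair_coeff1 u = pair_coeff1 v"
  by (auto simp: pair_coeff0_def pair_coeff1_def prod_eq_iff trunc.expand)

lemma pair_coeff_simps [simp]:
  fixes u v :: "'g::ab_group_add trunc \<times> 'h::ab_group_add trunc"
  shows "pair_coeff0 (0 :: 'g trunc \<times> 'h trunc) = 0"
  "pair_coeff1 (0 :: 'g trunc \<times> 'h trunc) = 0"
  "pair_coeff0 (u + v) = pair_coeff0 u + pair_coeff0 v"
  "pair_coeff1 (u + v) = pair_coeff1 u + pair_coeff1 v"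
  by (simp_all add: pair_coeff0_def pair_coeff1_def zero_prod_def zero_trunc_def plus_trunc_def)

lemma pair_coeffs_surj:
  obtains u where "pair_coeff0 u = a" "pair_coeff1 u = b"
  by (rule that[of "(Trunc (fst a) (fst b), Trunc (snd a) (snd b))"])
     (simp_all add: pair_coeff0_def pair_coeff1_def)

text \<open>The formula of \<open>bicrossed\<close> is additive in the quadruple of maps, so the
  deformed quadruple yields the bilinear extension of
  \<open>bicrossed M + t bicrossed D\<close>.\<close>

lemma bicrossed_deformed_coeffs:
  "pair_coeff0 (bicrossed (deformed M D) u v) = bicrossed M (pair_coeff0 u) (pair_coeff0 v)"
  "pair_coeff1 (bicrossed (deformed M D) u v) =
    bicrossed M (pair_coeff0 u) (pair_coeff1 v) + bicrossed M (pair_coeff1 u) (pair_coeff0 v)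
    + bicrossed D (pair_coeff0 u) (pair_coeff0 v)"
  by (cases M; cases D; cases u; cases v;
      simp add: pair_coeff0_def pair_coeff1_def trunc_bilinear_def plus_trunc_def minus_trunc_def)+

lemma deformed_bilinear_structures:
  assumes "M \<in> bilinear_structures sg sh" "D \<in> bilinear_structures sg sh"
  shows "deformed M D \<in> bilinear_structures (trunc_scale sg) (trunc_scale sh)"
proof -
  obtain brg brh \<rho> \<psi> where M: "M = (brg, brh, \<rho>, \<psi>)" by (cases M)
  obtain \<mu>1 \<nu>1 \<rho>1 \<psi>1 where D: "D = (\<mu>1, \<nu>1, \<rho>1, \<psi>1)" by (cases D)
  interpret M: bilinear_structure sg sh brg brh \<rho> \<psi>
    using assms(1) by (simp add: M bilinear_structures_def)
  interpret D: bilinear_structure sg sh \<mu>1 \<nu>1 \<rho>1 \<psi>1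
    using assms(2) by (simp add: D bilinear_structures_def)
  note m = M.g.module_axioms M.h.module_axioms
  have "bilinear_structure (trunc_scale sg) (trunc_scale sh) (trunc_bilinear brg \<mu>1)
      (trunc_bilinear brh \<nu>1) (trunc_bilinear \<rho> \<rho>1) (trunc_bilinear \<psi> \<psi>1)"
  proof (intro bilinear_structure.intro bilinear_structure_axioms.intro module_trunc_scale m
      trunc_bilinear_bilinear_map M.bilinear D.bilinear)
    \<comment> \<open>In the \<open>t\<close>-coefficient the two terms pairing
      \<open>coeff0 u\<close> with \<open>coeff1 u\<close> cancel by skew-symmetry of
      \<open>brg\<close>, and \<open>\<mu>1\<close> vanishes on the diagonal.\<close>
    show "trunc_bilinear brg \<mu>1 u u = 0" for u
      using M.skew_g[of "coeff0 u" "coeff1 u"]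
      by (simp add: trunc_bilinear_def zero_trunc_def M.alternating D.alternating)
    show "trunc_bilinear brh \<nu>1 u u = 0" for u
      using M.skew_h[of "coeff0 u" "coeff1 u"]
      by (simp add: trunc_bilinear_def zero_trunc_def M.alternating D.alternating)
  qed
  then show ?thesis by (simp add: M D bilinear_structures_def)
qed

text \<open>The constant coefficient of the Jacobi sum of the deformed bracket vanishes because
  \<open>\<pi>\<close> satisfies Jacobi. Its \<open>t\<close>-coefficient is the displayed sum, each
  term mixing one \<open>\<pi>\<close> with one \<open>F\<close>, plus Jacobi sums of
  \<open>\<pi>\<close>; so the condition is linear in \<open>F\<close> and concerns only constant
  coefficients of the arguments.\<close>

lemma infinitesimal_deformations_iff:
  fixes sg :: "'k::field_char_0 \<Rightarrow> 'g::ab_group_add \<Rightarrow> 'g"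
    and sh :: "'k \<Rightarrow> 'h::ab_group_add \<Rightarrow> 'h"
  assumes vs: "vector_space sg" "vector_space sh"
    and mp: "matched_pair sg sh brg brh \<rho> \<psi>"
  defines "M \<equiv> (brg, brh, \<rho>, \<psi>)"
  defines "\<pi> \<equiv> bicrossed M"
  shows "D \<in> infinitesimal_deformations sg sh M \<longleftrightarrow> D \<in> bilinear_structures sg sh \<and>
    (\<forall>a b c. let F = bicrossed D in
      \<pi> a (F b c) + F a (\<pi> b c) + (\<pi> b (F c a) + F b (\<pi> c a)) + (\<pi> c (F a b) + F c (\<pi> a b)) = 0)"
    (is "_ \<longleftrightarrow> _ \<and> ?J")
proof -
  obtain \<mu>1 \<nu>1 \<rho>1 \<psi>1 where D: "D = (\<mu>1, \<nu>1, \<rho>1, \<psi>1)" by (cases D)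
  have MB: "M \<in> bilinear_structures sg sh"
    unfolding M_def by (rule matched_pair_bilinear_structures[OF mp])
  have Mj: "\<pi> u (\<pi> v w) + \<pi> v (\<pi> w u) + \<pi> w (\<pi> u v) = 0" for u v w
    using matched_pair_iff_jacobi[OF MB[unfolded M_def]] mp unfolding \<pi>_def M_def by blast
  have m: "module sg" "module sh"
    using vs by (simp_all add: module_iff_vector_space)
  have skew: "skew_symmetric \<mu>1 \<longleftrightarrow> (\<forall>x. \<mu>1 x x = 0)" if "bilinear_map sg sg sg \<mu>1"
    using alternating_imp_skew[OF that] self_negative_imp_zero[OF vs(1)]
    unfolding skew_symmetric_def by metis
  have skew': "skew_symmetric \<nu>1 \<longleftrightarrow> (\<forall>x. \<nu>1 x x = 0)" if "bilinear_map sh sh sh \<nu>1"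
    using alternating_imp_skew[OF that] self_negative_imp_zero[OF vs(2)]
    unfolding skew_symmetric_def by metis
  have bs: "D \<in> bilinear_structures sg sh \<longleftrightarrow>
      bilinear_map sg sg sg \<mu>1 \<and> skew_symmetric \<mu>1 \<and> bilinear_map sh sh sh \<nu>1 \<and> skew_symmetric \<nu>1 \<and>
      bilinear_map sg sh sh \<rho>1 \<and> bilinear_map sh sg sg \<psi>1"
    using skew skew' m
    by (auto simp: D bilinear_structures_def bilinear_structure_def bilinear_structure_axioms_def)
  have "(case deformed M D of (\<mu>t, \<nu>t, \<rho>t, \<psi>t) \<Rightarrow>
        matched_pair (trunc_scale sg) (trunc_scale sh) \<mu>t \<nu>t \<rho>t \<psi>t) \<longleftrightarrow> ?J"
    if DB: "D \<in> bilinear_structures sg sh"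
  proof -
    let ?\<pi>t = "bicrossed (deformed M D)"
    let ?F = "bicrossed D"
    have j: "(case deformed M D of (\<mu>t, \<nu>t, \<rho>t, \<psi>t) \<Rightarrow>
        matched_pair (trunc_scale sg) (trunc_scale sh) \<mu>t \<nu>t \<rho>t \<psi>t) \<longleftrightarrow>
        (\<forall>u v w. ?\<pi>t u (?\<pi>t v w) + ?\<pi>t v (?\<pi>t w u) + ?\<pi>t w (?\<pi>t u v) = 0)"
      using deformed_bilinear_structures[OF MB DB]
      by (cases "deformed M D") (simp only: prod.case matched_pair_iff_jacobi)
    have e: "?\<pi>t u (?\<pi>t v w) + ?\<pi>t v (?\<pi>t w u) + ?\<pi>t w (?\<pi>t u v) = 0 \<longleftrightarrow>
        \<pi> a (?F b c) + ?F a (\<pi> b c) + (\<pi> b (?F c a) + ?F b (\<pi> c a))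
        + (\<pi> c (?F a b) + ?F c (\<pi> a b)) = 0"
      if "a = pair_coeff0 u" "b = pair_coeff0 v" "c = pair_coeff0 w" for u v w a b c
    proof -
      define a' b' c' where "a' = pair_coeff1 u" "b' = pair_coeff1 v" "c' = pair_coeff1 w"
      note d = that[symmetric] this[symmetric]
      have "pair_coeff0 (?\<pi>t u (?\<pi>t v w) + ?\<pi>t v (?\<pi>t w u) + ?\<pi>t w (?\<pi>t u v)) = 0"
        by (simp add: bicrossed_deformed_coeffs Mj[unfolded \<pi>_def])
      \<comment> \<open>One Jacobi sum of \<open>\<pi>\<close> for each argument replaced by its
        \<open>t\<close>-coefficient; these three vanish by \<open>Mj\<close>.\<close>
      moreover have "pair_coeff1 (?\<pi>t u (?\<pi>t v w) + ?\<pi>t v (?\<pi>t w u) + ?\<pi>t w (?\<pi>t u v)) =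
          (\<pi> a' (\<pi> b c) + \<pi> b (\<pi> c a') + \<pi> c (\<pi> a' b)) +
          (\<pi> a (\<pi> b' c) + \<pi> b' (\<pi> c a) + \<pi> c (\<pi> a b')) +
          (\<pi> a (\<pi> b c') + \<pi> b (\<pi> c' a) + \<pi> c' (\<pi> a b)) +
          (\<pi> a (?F b c) + ?F a (\<pi> b c) + (\<pi> b (?F c a) + ?F b (\<pi> c a))
            + (\<pi> c (?F a b) + ?F c (\<pi> a b)))"
        by (simp add: bicrossed_deformed_coeffs d bicrossed_simps(1,2)[OF MB] \<pi>_def algebra_simps)
      ultimately show ?thesis
        by (simp add: pair_trunc_eq_iff Mj)
    qed
    \<comment> \<open>Every triple \<open>a\<close>, \<open>b\<close>, \<open>c\<close> occurs as
      constant coefficients, so quantifying over truncated arguments or over such triples is the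
      same.\<close>
    show ?thesis
      unfolding j Let_def by (metis e pair_coeffs_surj)
  qed
  then show ?thesis
    unfolding bs by (auto simp: infinitesimal_deformations_def D simp del: deformed.simps)
qed

section \<open>Equivalence of deformations\<close>

text \<open>On pure vectors the components of the single equation are the two bracket and the two
  action conditions; bilinearity of the brackets and linearity of \<open>f\<close>, \<open>g\<close>
  extend them to all pairs.\<close>

lemma matched_pair_hom_iff_bicrossed:
  assumes "M \<in> bilinear_structures sg sh" "N \<in> bilinear_structures sg' sh'"
  shows "matched_pair_hom sg sh M sg' sh' N f g \<longleftrightarrow>
    module_hom sg sg' f \<and> module_hom sh sh' g \<and>
    (\<forall>u v. map_prod f g (bicrossed M u v) = bicrossed N (map_prod f g u) (map_prod f g v))"
proof (cases "module_hom sg sg' f \<and> module_hom sh sh' g")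
  case True
  obtain brg brh \<rho> \<psi> where M: "M = (brg, brh, \<rho>, \<psi>)" by (cases M)
  obtain brg' brh' \<rho>' \<psi>' where N: "N = (brg', brh', \<rho>', \<psi>')" by (cases N)
  interpret M: bilinear_structure sg sh brg brh \<rho> \<psi>
    using assms(1) by (simp add: M bilinear_structures_def)
  interpret N: bilinear_structure sg' sh' brg' brh' \<rho>' \<psi>'
    using assms(2) by (simp add: N bilinear_structures_def)
  interpret f: module_hom sg sg' f using True by simp
  interpret g: module_hom sh sh' g using True by simp
  note s = M.maps_simps N.maps_simps f.add f.diff f.zero f.neg g.add g.diff g.zero g.neg
  have "(\<forall>u v. map_prod f g (bicrossed M u v) = bicrossed N (map_prod f g u) (map_prod f g v)) \<longleftrightarrow>
      (\<forall>x y. f (brg x y) = brg' (f x) (f y)) \<and> (\<forall>h k. g (brh h k) = brh' (g h) (g k)) \<and>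
      (\<forall>x h. g (\<rho> x h) = \<rho>' (f x) (g h)) \<and> (\<forall>h x. f (\<psi> h x) = \<psi>' (g h) (f x))"
    (is "?E \<longleftrightarrow> ?C")
  proof
    assume e: ?E
    have "f (brg x y) = brg' (f x) (f y)" "g (brh h k) = brh' (g h) (g k)"
      "g (\<rho> x h) = \<rho>' (f x) (g h)" "f (\<psi> h x) = \<psi>' (g h) (f x)" for x y h k
      using e[rule_format, of "(x, 0)" "(y, 0)"] e[rule_format, of "(0, h)" "(0, k)"]
        e[rule_format, of "(x, 0)" "(0, h)"]
      by (simp_all add: M N s)
    then show ?C by blast
  next
    assume ?C
    then show ?E by (simp add: M N s split_paired_all)
  qed
  then show ?thesis
    using True unfolding M N matched_pair_hom.simps lie_hom_def by blast
next
  case False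
  then show ?thesis
    by (cases M; cases N) (auto simp: lie_hom_def)
qed

lemma id_plus_t_module_hom:
  assumes "module_hom s s f"
  shows "module_hom (trunc_scale s) (trunc_scale s) (id_plus_t f)"
proof -
  interpret module_hom s s f by fact
  show ?thesis
    by (intro module_hom.intro module_hom_axioms.intro module_trunc_scale m1.module_axioms)
       (simp_all add: id_plus_t_def plus_trunc_def trunc_scale_def add scale m1.scale_right_distrib)
qed

lemma id_plus_t_coeffs:
  "pair_coeff0 (map_prod (id_plus_t f) (id_plus_t g) u) = pair_coeff0 u"
  "pair_coeff1 (map_prod (id_plus_t f) (id_plus_t g) u) = pair_coeff1 u + map_prod f g (pair_coeff0 u)"
  by (cases u; simp add: pair_coeff0_def pair_coeff1_def id_plus_t_def)+

text \<open>Modulo \<open>t\<close> the map \<open>id + t \<phi>\<close> is the identity, so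
  constant coefficients agree. In the \<open>t\<close>-coefficients all terms with a
  \<open>t\<close>-coefficient of an argument cancel, and \<open>bicrossed D a b + \<phi> (\<pi> a
  b) = \<pi> a (\<phi> b) + \<pi> (\<phi> a) b + bicrossed D' a b\<close> remains.\<close>

lemma deformed_hom_iff:
  assumes MB: "M \<in> bilinear_structures sg sh"
    and DB: "D \<in> bilinear_structures sg sh" "D' \<in> bilinear_structures sg sh"
    and f: "module_hom sg sg f" and g: "module_hom sh sh g"
  defines "\<pi> \<equiv> bicrossed M" and "\<phi> \<equiv> map_prod f g"
  shows "matched_pair_hom (trunc_scale sg) (trunc_scale sh) (deformed M D)
      (trunc_scale sg) (trunc_scale sh) (deformed M D') (id_plus_t f) (id_plus_t g) \<longleftrightarrow>
    (\<forall>a b. bicrossed D a b - bicrossed D' a b = \<pi> (\<phi> a) b + \<pi> a (\<phi> b) - \<phi> (\<pi> a b))"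
proof -
  let ?\<Phi> = "map_prod (id_plus_t f) (id_plus_t g)"
  have e: "?\<Phi> (bicrossed (deformed M D) u v) = bicrossed (deformed M D') (?\<Phi> u) (?\<Phi> v) \<longleftrightarrow>
      bicrossed D a b - bicrossed D' a b = \<pi> (\<phi> a) b + \<pi> a (\<phi> b) - \<phi> (\<pi> a b)"
    if "a = pair_coeff0 u" "b = pair_coeff0 v" for a b u v
    by (simp add: pair_trunc_eq_iff id_plus_t_coeffs bicrossed_deformed_coeffs that
        bicrossed_simps(1,2)[OF MB] \<pi>_def \<phi>_def) (auto simp: algebra_simps)
  show ?thesis
    unfolding matched_pair_hom_iff_bicrossed[OF deformed_bilinear_structures[OF MB DB(1)]
        deformed_bilinear_structures[OF MB DB(2)]]
    using id_plus_t_module_hom[OF f] id_plus_t_module_hom[OF g] by (metis e pair_coeffs_surj)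
qed

section \<open>Cochains of low degree\<close>

lemma permutes_2: "\<sigma> permutes {..<2::nat} \<longleftrightarrow> \<sigma> = id \<or> \<sigma> = transpose 0 1"
proof -
  have "{..<2::nat} = {0, 1}" by auto
  then show ?thesis by (simp add: permutes_doubleton_iff)
qed

lemma unshuffles_2_0: "unshuffles 2 0 = {id}"
  and unshuffles_1_1: "unshuffles 1 1 = {id, transpose 0 1}"
proof -
  have "strict_mono_on {..<2} \<sigma> \<longleftrightarrow> \<sigma> 0 < \<sigma> 1" for \<sigma> :: "nat \<Rightarrow> nat"
    by (auto simp: strict_mono_on_def less_Suc_eq numeral_2_eq_2)
  moreover have "strict_mono_on {..<1} \<sigma>" "strict_mono_on {1..<2} \<sigma>"
    "strict_mono_on {2..<2} \<sigma>" for \<sigma> :: "nat \<Rightarrow> nat"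
    by (auto simp: strict_mono_on_def)
  ultimately show "unshuffles 2 0 = {id}" "unshuffles 1 1 = {id, transpose 0 1}"
    unfolding unshuffles_def add_0_right one_add_one permutes_2 by auto
qed

text \<open>A shuffle of type (2, 1) is determined by its value at 2, the other two values being
  increasing. The value sequences are 0 1 2, 0 2 1 and 1 2 0, in the order listed.\<close>

lemma unshuffles_2_1:
  "unshuffles 2 1 = {id, transpose 1 2, transpose 0 1 \<circ> transpose 1 2}" (is "_ = ?S")
proof (intro equalityI subsetI)
  have lt3: "i = 0 \<or> i = 1 \<or> i = 2" if "i < 3" for i :: nat
    using that by auto
  fix \<sigma> :: "nat \<Rightarrow> nat"
  assume "\<sigma> \<in> unshuffles 2 1"
  then have p: "\<sigma> permutes {..<3}" and "strict_mono_on {..<2} \<sigma>"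
    by (simp_all add: unshuffles_def)
  then have less: "\<sigma> 0 < \<sigma> 1"
    by (auto simp: strict_mono_on_def)
  have bound: "\<sigma> i < 3" if "i < 3" for i
    using permutes_in_image[OF p, of i] that by simp
  have out: "\<sigma> i = i" if "\<not> i < 3" for i
    using permutes_not_in[OF p, of i] that by simp
  have inj: "\<sigma> 2 \<noteq> \<sigma> 0" "\<sigma> 2 \<noteq> \<sigma> 1"
    using inj_eq[OF permutes_inj[OF p]] by simp_all
  have ext: "\<sigma> = \<tau>" if "\<sigma> 0 = \<tau> 0" "\<sigma> 1 = \<tau> 1" "\<sigma> 2 = \<tau> 2" "\<And>i. \<not> i < 3 \<Longrightarrow> \<tau> i = i" for \<tau>
  proof (rule HOL.ext)
    show "\<sigma> i = \<tau> i" for i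
      using that out[of i] lt3[of i] by (cases "i < 3") auto
  qed
  consider "\<sigma> 0 = 0" "\<sigma> 1 = 1" "\<sigma> 2 = 2" | "\<sigma> 0 = 0" "\<sigma> 1 = 2" "\<sigma> 2 = 1"
    | "\<sigma> 0 = 1" "\<sigma> 1 = 2" "\<sigma> 2 = 0"
    using lt3[OF bound, of 0] lt3[OF bound, of 1] lt3[OF bound, of 2] less inj by auto
  then show "\<sigma> \<in> ?S"
  proof cases
    case 1
    then have "\<sigma> = id" by (intro ext) auto
    then show ?thesis by simp
  next
    case 2
    then have "\<sigma> = transpose 1 2" by (intro ext) (auto simp: transpose_def)
    then show ?thesis by simp
  next
    case 3
    then have "\<sigma> = transpose 0 1 \<circ> transpose 1 2" by (intro ext) (auto simp: transpose_def)
    then show ?thesis by simp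
  qed
next
  fix \<sigma> :: "nat \<Rightarrow> nat"
  assume "\<sigma> \<in> ?S"
  moreover have "transpose 0 1 permutes {..<3::nat}" "transpose 1 2 permutes {..<3::nat}"
    by (auto intro: permutes_swap_id)
  ultimately have "\<sigma> permutes {..<3}"
    using permutes_compose[of "transpose 1 2" "{..<3::nat}" "transpose 0 1"] permutes_id by auto
  moreover have "strict_mono_on {..<2} \<sigma>"
    using \<open>\<sigma> \<in> ?S\<close> by (auto simp: strict_mono_on_def less_Suc_eq numeral_2_eq_2 transpose_def)
  ultimately show "\<sigma> \<in> unshuffles 2 1"
    by (auto simp: unshuffles_def strict_mono_on_def)
qed

section \<open>Insertions and skew-symmetric maps of low arity\<close>

context vector_space
begin

lemma nr_insert_1_0: "nr_insert scale 1 0 f g z = g (\<lambda>i. if i = 0 then f z else z (Suc i))"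
  unfolding nr_insert_def one_add_one unshuffles_2_0 by (simp cong: if_cong)

lemma nr_insert_0_1:
  "nr_insert scale 0 1 f g z =
    g (\<lambda>i. if i = 0 then f z else z i) -
    g (\<lambda>i. if i = 0 then f (z \<circ> transpose 0 1) else z (transpose 0 1 i))"
proof -
  have "id \<noteq> (transpose 0 1 :: nat \<Rightarrow> nat)"
    by (rule neq_funI[of _ 0]) simp
  then show ?thesis
    unfolding nr_insert_def add_0 unshuffles_1_1 by (simp add: sign_swap_id comp_def cong: if_cong)
qed

text \<open>The identity and the 3-cycle are even, the transposition is odd. \<open>f\<close> and
  \<open>g\<close> are arbitrary functions of sequences here, so whole argument sequences are
  kept.\<close>

lemma nr_insert_1_1:
  "nr_insert scale 1 1 f g z =
    g (\<lambda>i. if i = 0 then f z else z (Suc i)) -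
    g (\<lambda>i. if i = 0 then f (z \<circ> transpose 1 2) else z (transpose 1 2 (Suc i))) +
    g (\<lambda>i. if i = 0 then f (z \<circ> transpose 0 1 \<circ> transpose 1 2)
      else z (transpose 0 1 (transpose 1 2 (Suc i))))"
proof -
  let ?s = "transpose 1 2 :: nat \<Rightarrow> nat" and ?r = "transpose 0 1 \<circ> transpose 1 2 :: nat \<Rightarrow> nat"
  \<comment> \<open>The shuffles must be distinct for the sum over their set to have three terms;
    each pair is told apart by one value.\<close>
  have "id \<noteq> ?s" by (rule neq_funI[of _ 1]) (simp add: transpose_def)
  moreover have "id \<noteq> ?r" by (rule neq_funI[of _ 1]) (simp add: transpose_def)
  moreover have "?s \<noteq> ?r" by (rule neq_funI[of _ 0]) (simp add: transpose_def)
  moreover have "sign ?r = 1"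
    by (simp add: sign_compose permutation_swap_id sign_swap_id)
  ultimately show ?thesis
    unfolding nr_insert_def one_add_one unshuffles_2_1
    by (simp add: sign_swap_id comp_def cong: if_cong)
qed

text \<open>A map reading two entries of a sequence is a function of two vectors, and the only
  nontrivial permutation of two positions is the swap, of sign -1.\<close>

lemma skew_multilinear_2_iff:
  "skew_multilinear scale 2 F \<longleftrightarrow>
    (\<exists>B. bilinear_map scale scale scale B \<and> (\<forall>u v. B u v = - B v u) \<and> F = (\<lambda>z. B (z 0) (z 1)))"
    (is "_ \<longleftrightarrow> ?R")
proof
  assume F: "skew_multilinear scale 2 F"
  \<comment> \<open>Beyond position 1 the sequence is filled with \<open>v\<close>; by
    \<open>cong\<close> these entries do not influence the value.\<close>
  define B where "B u v = F (\<lambda>i. if i = 0 then u else v)" for u v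
  have cong: "F z = F z'" if "z 0 = z' 0" "z 1 = z' 1" for z z'
    using F that unfolding skew_multilinear_def multilinear_def by (metis less_2_cases_iff One_nat_def)
  have "module_hom scale scale (\<lambda>v. F (z(i := v)))" if "i < 2" for i z
    using F that unfolding skew_multilinear_def multilinear_def module_hom_iff_linear by blast
  from this[of 0 "\<lambda>_. _"] this[of 1 "\<lambda>_. _"]
  have "module_hom scale scale (\<lambda>v. F ((\<lambda>_. w)(0 := v)))"
    "module_hom scale scale (\<lambda>v. F ((\<lambda>_. w)(1 := v)))" for w
    by simp_all
  moreover have "F ((\<lambda>_. w)(0 := v)) = B v w" "F ((\<lambda>_. w)(1 := v)) = B w v" for v w
    by (auto simp: B_def intro: cong)
  ultimately have "bilinear_map scale scale scale B"
    by (simp add: bilinear_map_def)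
  moreover have "B u v = - B v u" for u v
  proof -
    let ?z = "\<lambda>i::nat. if i = 0 then v else u"
    have "F (\<lambda>i. ?z (transpose 0 1 i)) = scale (of_int (sign (transpose 0 1 :: nat \<Rightarrow> nat))) (F ?z)"
      by (rule F[unfolded skew_multilinear_def, THEN conjunct2, rule_format, of "transpose 0 1" ?z])
        (simp add: permutes_2)
    moreover have "F (\<lambda>i. ?z (transpose 0 1 i)) = B u v"
      unfolding B_def by (rule cong) (auto simp: transpose_def)
    ultimately show ?thesis by (simp add: B_def sign_swap_id)
  qed
  moreover have "F = (\<lambda>z. B (z 0) (z 1))"
    by (auto simp: B_def fun_eq_iff intro: cong)
  ultimately show ?R by blast
next
  assume ?R
  then obtain B where B: "bilinear_map scale scale scale B" "\<And>u v. B u v = - B v u"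
    and F: "F = (\<lambda>z. B (z 0) (z 1))" by blast
  have "Vector_Spaces.linear scale scale (\<lambda>v. F (z(i := v)))" if "i < 2" for i z
    using B(1) that by (auto simp: less_2_cases_iff F bilinear_map_def module_hom_iff_linear)
  moreover have "F (\<lambda>i. z (\<sigma> i)) = scale (of_int (sign \<sigma>)) (F z)" if "\<sigma> permutes {..<2}" for \<sigma> z
    using that B(2)[of "z 1" "z 0"] by (auto simp: permutes_2 F sign_swap_id)
  ultimately show "skew_multilinear scale 2 F"
    by (simp add: skew_multilinear_def multilinear_def F)
qed

lemma skew_multilinear_1_iff:
  "skew_multilinear scale 1 F \<longleftrightarrow>
    (\<exists>\<phi>. Vector_Spaces.linear scale scale \<phi> \<and> F = (\<lambda>z. \<phi> (z 0)))" (is "_ \<longleftrightarrow> ?R")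
proof
  assume F: "skew_multilinear scale 1 F"
  define \<phi> where "\<phi> v = F (\<lambda>_. v)" for v
  have cong: "F z = F z'" if "z 0 = z' 0" for z z'
    using F that unfolding skew_multilinear_def multilinear_def by (metis less_one)
  have "Vector_Spaces.linear scale scale (\<lambda>v. F ((\<lambda>_. 0)(0 := v)))"
    using F unfolding skew_multilinear_def multilinear_def by blast
  moreover have "F ((\<lambda>_. 0)(0 := v)) = \<phi> v" for v
    unfolding \<phi>_def by (rule cong) simp
  moreover have "F = (\<lambda>z. \<phi> (z 0))"
    by (auto simp: \<phi>_def fun_eq_iff intro: cong)
  ultimately show ?R by auto
next
  assume ?R
  then show "skew_multilinear scale 1 F"
    by (auto simp: skew_multilinear_def multilinear_def lessThan_Suc)
qed

end

section \<open>The cochain spaces in degrees 2 and 1\<close>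

lemma vector_space_module_prod:
  assumes "vector_space sg" "vector_space sh"
  shows "vector_space (module_prod.scale sg sh)" "module_prod sg sh"
proof -
  interpret sg: vector_space sg by fact
  interpret sh: vector_space sh by fact
  interpret vector_space_prod sg sh by unfold_locales
  show "vector_space (module_prod.scale sg sh)" "module_prod sg sh"
    by unfold_locales
qed

lemma skew_multilinear_mpl_pi:
  assumes "vector_space sg" "vector_space sh" and D: "D \<in> bilinear_structures sg sh"
  shows "skew_multilinear (module_prod.scale sg sh) 2 (mpl_pi D)"
  unfolding vector_space.skew_multilinear_2_iff[OF vector_space_module_prod(1)[OF assms(1,2)]]
  using bilinear_structuresD(3)[OF D] bicrossed_skew[OF D] mpl_pi_eq_bicrossed by blast

lemma bilinear_map_zero:
  assumes "module s1" "module s2" "module s3"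
  shows "bilinear_map s1 s2 s3 (\<lambda>_ _. 0)"
proof -
  interpret module s3 by fact
  show ?thesis by (intro bilinear_mapI assms) simp_all
qed

text \<open>Bidegree 1|0 carries the components of a bracket on \<gg> and of \<open>\<rho>\<close>,
  bidegree 0|1 those of a bracket on \<hh> and of \<open>\<psi>\<close>. Together they allow every
  component of a skew-symmetric bilinear map except the \<hh> component on \<gg> \<times> \<gg> and
  the \<gg> component on \<hh> \<times> \<hh>, exactly the two absent from
  \<open>bicrossed\<close>.\<close>

lemma mpl_cochains_2:
  fixes sg :: "'k::field_char_0 \<Rightarrow> 'g::ab_group_add \<Rightarrow> 'g"
    and sh :: "'k \<Rightarrow> 'h::ab_group_add \<Rightarrow> 'h"
  assumes vs: "vector_space sg" "vector_space sh"
  shows "mpl_cochains sg sh 2 = mpl_pi ` bilinear_structures sg sh"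
proof (intro equalityI subsetI)
  note v = vector_space_module_prod[OF vs]
  note iff = vector_space.skew_multilinear_2_iff[OF v(1)]
  have two: "{..<2::nat} = {0, 1}" by auto
  interpret gh: module_prod sg sh by (rule v(2))
  {
    fix F assume "F \<in> mpl_cochains sg sh 2"
    then obtain G where G: "\<And>l. l < 2 \<Longrightarrow> G l \<in> bidegree_cochains sg sh (2 - 1 - l) l"
      and F: "F = (\<lambda>z. \<Sum>l<2. G l z)"
      by (auto simp: mpl_cochains_def)
    have G0: "G 0 \<in> bidegree_cochains sg sh 1 0" and G1: "G 1 \<in> bidegree_cochains sg sh 0 1"
      using G[of 0] G[of 1] by simp_all
    have "skew_multilinear gh.scale 2 (G 0)" "skew_multilinear gh.scale 2 (G 1)"
      using G0 G1 by (simp_all add: bidegree_cochains_def numeral_2_eq_2)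
    note GB = this[unfolded iff]
    obtain B0 where B0: "bilinear_map gh.scale gh.scale gh.scale B0" "\<And>u v. B0 u v = - B0 v u"
      and G0': "G 0 = (\<lambda>z. B0 (z 0) (z 1))"
      using GB(1) by blast
    obtain B1 where B1: "bilinear_map gh.scale gh.scale gh.scale B1" "\<And>u v. B1 u v = - B1 v u"
      and G1': "G 1 = (\<lambda>z. B1 (z 0) (z 1))"
      using GB(2) by blast
    have z: "snd (B0 (x, 0) (y, 0)) = 0" "fst (B0 (x, 0) (0, k)) = 0" "B0 (0, h) (0, k) = 0"
      "B1 (x, 0) (y, 0) = 0" "snd (B1 (x, 0) (0, k)) = 0" "fst (B1 (0, h) (0, k)) = 0" for x y h k
    proof -
      let ?x = "\<lambda>i::nat. if i = 0 then x else y" and ?h = "\<lambda>i::nat. if i = 0 then h else k"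
      \<comment> \<open>The patterns with two, one and no entries from \<gg>.
        \<open>mixed_args\<close> numbers the entries from \<hh> from 0 again, so the constant
        sequence \<open>k\<close> puts \<open>(0, k)\<close> second.\<close>
      have "G 0 (mixed_args 2 ?x ?h) \<in> UNIV \<times> {0}" "G 0 (mixed_args 1 ?x (\<lambda>_. k)) \<in> {0} \<times> UNIV"
        "G 0 (mixed_args 0 ?x ?h) = 0"
        using G0 unfolding bidegree_cochains_def by (simp_all add: numeral_2_eq_2)
      then show "snd (B0 (x, 0) (y, 0)) = 0" "fst (B0 (x, 0) (0, k)) = 0" "B0 (0, h) (0, k) = 0"
        by (simp_all add: G0' mixed_args_def mem_Times_iff)
      have "G 1 (mixed_args 2 ?x ?h) = 0" "G 1 (mixed_args 1 ?x (\<lambda>_. k)) \<in> UNIV \<times> {0}"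
        "G 1 (mixed_args 0 ?x ?h) \<in> {0} \<times> UNIV"
        using G1 unfolding bidegree_cochains_def by (simp_all add: numeral_2_eq_2)
      then show "B1 (x, 0) (y, 0) = 0" "snd (B1 (x, 0) (0, k)) = 0" "fst (B1 (0, h) (0, k)) = 0"
        by (simp_all add: G1'[unfolded One_nat_def] mixed_args_def mem_Times_iff)
    qed
    define B where "B u v = B0 u v + B1 u v" for u v
    have bil: "bilinear_map gh.scale gh.scale gh.scale B"
      by (rule bilinear_mapI)
        (simp_all add: B_def bilinear_map_simps[OF B0(1)] bilinear_map_simps[OF B1(1)]
          gh.p.module_axioms gh.p.scale_right_distrib algebra_simps)
    have skew: "B u v = - B v u" for u v
      using B0(2)[of u v] B1(2)[of u v] by (simp add: B_def)
    have alt: "B u u = 0" for u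
      by (rule self_negative_imp_zero[OF v(1) skew])
    have F': "F z = B (z 0) (z 1)" for z
      by (simp add: F two G0' G1'[unfolded One_nat_def] B_def)
    \<comment> \<open>Components of \<open>B\<close> on pure vectors; in the order
      \<open>(0, h)\<close>, \<open>(x, 0)\<close> the map \<open>\<psi>\<close> enters
      \<open>bicrossed\<close> with a plus sign.\<close>
    define D where "D = (\<lambda>x y. fst (B (x, 0) (y, 0)), \<lambda>h k. snd (B (0, h) (0, k)),
      \<lambda>x k. snd (B (x, 0) (0, k)), \<lambda>h x. fst (B (0, h) (x, 0)))"
    have pair: "(x + y, 0 :: 'h) = (x, 0) + (y, 0)" "(0 :: 'g, h + k) = (0, h) + (0, k)"
      "(sg c x, 0) = gh.scale c (x, 0)" "(0, sh c h) = gh.scale c (0, h)"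
      for x y :: 'g and h k :: 'h and c
      by (simp_all add: gh.scale_def)
    have scale: "fst (gh.scale c u) = sg c (fst u)" "snd (gh.scale c u) = sh c (snd u)" for c u
      by (simp_all add: gh.scale_def)
    have "D \<in> bilinear_structures sg sh"
      unfolding D_def bilinear_structures_def mem_Collect_eq prod.case
      by (intro bilinear_structure.intro bilinear_structure_axioms.intro bilinear_mapI
          gh.m1.module_axioms gh.m2.module_axioms)
        (simp_all only: pair bilinear_map_simps[OF bil] fst_add snd_add alt scale
          fst_zero snd_zero)
    moreover have "F = mpl_pi D"
    proof
      fix z :: "nat \<Rightarrow> 'g \<times> 'h"
      obtain x h y k where xy: "z 0 = (x, h)" "z 1 = (y, k)" by (metis surj_pair)
      have "F z = B ((x, 0) + (0, h)) ((y, 0) + (0, k))"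
        by (simp add: F' xy[unfolded One_nat_def] xy)
      also have "\<dots> = B (x, 0) (y, 0) + B (x, 0) (0, k) + B (0, h) (y, 0) + B (0, h) (0, k)"
        by (simp only: bilinear_map_simps[OF bil] add.assoc)
          (simp add: add.left_commute)
      \<comment> \<open>Skew-symmetry supplies the minus signs of the mixed terms, and the facts
        named \<open>z\<close> remove the two components that \<open>bicrossed\<close> does not
        have.\<close>
      also have "\<dots> = mpl_pi D z"
        using skew[of "(x, 0)" "(0, k)"] skew[of "(0, h)" "(y, 0)"]
        by (simp add: D_def xy[unfolded One_nat_def] xy prod_eq_iff)
          (simp add: B_def z)
      finally show "F z = mpl_pi D z" .
    qed
    ultimately show "F \<in> mpl_pi ` bilinear_structures sg sh" by blast
  next
    fix F assume "F \<in> mpl_pi ` bilinear_structures sg sh"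
    then obtain \<mu> \<nu> \<rho> \<psi> where D: "(\<mu>, \<nu>, \<rho>, \<psi>) \<in> bilinear_structures sg sh"
      and F: "F = mpl_pi (\<mu>, \<nu>, \<rho>, \<psi>)" by auto
    interpret bilinear_structure sg sh \<mu> \<nu> \<rho> \<psi>
      using D by (simp add: bilinear_structures_def)
    \<comment> \<open>The parts of \<open>F\<close> of bidegree 1|0 and 0|1.\<close>
    define G where "G l = (if l = 0 then mpl_pi (\<mu>, \<lambda>_ _. 0, \<rho>, \<lambda>_ _. 0)
      else mpl_pi (\<lambda>_ _. 0, \<nu>, \<lambda>_ _. 0, \<psi>))" for l :: nat
    note m = gh.m1.module_axioms gh.m2.module_axioms
    have "(\<mu>, \<lambda>_ _. 0, \<rho>, \<lambda>_ _. 0) \<in> bilinear_structures sg sh"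
      "(\<lambda>_ _. 0, \<nu>, \<lambda>_ _. 0, \<psi>) \<in> bilinear_structures sg sh"
      by (auto simp: bilinear_structures_def bilinear_structure_def bilinear_structure_axioms_def
          m bilinear alternating bilinear_map_zero)
    from this[THEN skew_multilinear_mpl_pi[OF vs]]
    have sk: "skew_multilinear gh.scale 2 (G l)" for l
      by (simp add: G_def)
    have "G 0 \<in> bidegree_cochains sg sh 1 0"
      using sk[of 0] unfolding bidegree_cochains_def
      by (auto simp: numeral_2_eq_2 G_def mixed_args_def maps_simps zero_prod_def le_Suc_eq)
    moreover have "G 1 \<in> bidegree_cochains sg sh 0 1"
      using sk[of 1] unfolding bidegree_cochains_def
      by (auto simp: numeral_2_eq_2 G_def mixed_args_def maps_simps zero_prod_def le_Suc_eq)
    moreover have "F = (\<lambda>z. \<Sum>l<2. G l z)"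
      by (auto simp: F two G_def split: prod.split)
    ultimately show "F \<in> mpl_cochains sg sh 2"
      unfolding mpl_cochains_def by (auto simp: less_2_cases_iff intro!: exI[of _ G])
  }
qed

text \<open>Only bidegree 0|0 occurs in degree 1, and a linear map on \<gg> \<oplus> \<hh> that
  preserves both summands is block diagonal.\<close>

lemma mpl_cochains_1:
  assumes vs: "vector_space sg" "vector_space sh"
  shows "mpl_cochains sg sh 1 =
    {\<lambda>z. map_prod f g (z 0) | f g. module_hom sg sg f \<and> module_hom sh sh g}"
proof -
  note v = vector_space_module_prod[OF vs]
  interpret gh: module_prod sg sh by (rule v(2))
  have "mpl_cochains sg sh 1 = bidegree_cochains sg sh 0 0"
    by (auto simp: mpl_cochains_def lessThan_Suc intro: exI[of _ "\<lambda>_. _"])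
  also have "\<dots> = {\<lambda>z. \<phi> (z 0) | \<phi>. module_hom gh.scale gh.scale \<phi> \<and>
      (\<forall>x. \<phi> (x, 0) \<in> UNIV \<times> {0}) \<and> (\<forall>h. \<phi> (0, h) \<in> {0} \<times> UNIV)}" (is "_ = ?R")
  proof (intro equalityI subsetI)
    fix F assume "F \<in> bidegree_cochains sg sh 0 0"
    then have F: "skew_multilinear gh.scale 1 F"
      and 1: "\<And>x h. F (mixed_args 1 x h) \<in> UNIV \<times> {0}" "\<And>x h. F (mixed_args 0 x h) \<in> {0} \<times> UNIV"
      by (simp_all add: bidegree_cochains_def)
    from F obtain \<phi> where \<phi>: "module_hom gh.scale gh.scale \<phi>" and F: "F = (\<lambda>z. \<phi> (z 0))"
      unfolding vector_space.skew_multilinear_1_iff[OF v(1)] module_hom_iff_linear by blast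
    have "\<phi> (x, 0) \<in> UNIV \<times> {0}" "\<phi> (0, h) \<in> {0} \<times> UNIV" for x h
      using 1(1)[of "\<lambda>_. x" "\<lambda>_. h"] 1(2)[of "\<lambda>_. x" "\<lambda>_. h"]
      by (simp_all add: F mixed_args_def)
    with \<phi> F show "F \<in> ?R" by blast
  next
    fix F assume "F \<in> ?R"
    then obtain \<phi> where \<phi>: "module_hom gh.scale gh.scale \<phi>" "\<And>x. \<phi> (x, 0) \<in> UNIV \<times> {0}"
      "\<And>h. \<phi> (0, h) \<in> {0} \<times> UNIV" and F: "F = (\<lambda>z. \<phi> (z 0))" by blast
    from \<phi>(1) F have "skew_multilinear gh.scale 1 F"
      unfolding vector_space.skew_multilinear_1_iff[OF v(1)] module_hom_iff_linear by blast
    then show "F \<in> bidegree_cochains sg sh 0 0"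
      using \<phi>(2,3) by (auto simp: bidegree_cochains_def F mixed_args_def le_Suc_eq)
  qed
  also have "\<dots> = {\<lambda>z. map_prod f g (z 0) | f g. module_hom sg sg f \<and> module_hom sh sh g}"
    (is "_ = ?S")
  proof (intro equalityI subsetI)
    fix F assume "F \<in> ?R"
    then obtain \<phi> where \<phi>: "module_hom gh.scale gh.scale \<phi>" "\<And>x. \<phi> (x, 0) \<in> UNIV \<times> {0}"
      "\<And>h. \<phi> (0, h) \<in> {0} \<times> UNIV" and F: "F = (\<lambda>z. \<phi> (z 0))" by blast
    interpret \<phi>: module_hom gh.scale gh.scale \<phi> by fact
    define f g where "f x = fst (\<phi> (x, 0))" and "g h = snd (\<phi> (0, h))" for x h
    have "\<phi> u = map_prod f g u" for u
    proof -
      have "\<phi> u = \<phi> (fst u, 0) + \<phi> (0, snd u)"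
        by (simp flip: \<phi>.add)
      then show ?thesis
        using \<phi>(2)[of "fst u"] \<phi>(3)[of "snd u"] by (auto simp: f_def g_def prod_eq_iff mem_Times_iff)
    qed
    moreover have "module_hom sg sg f"
      using \<phi>.add[of "(_, 0)" "(_, 0)"] \<phi>.scale[of _ "(_, 0)"]
      by (auto simp: module_hom_def module_hom_axioms_def gh.m1.module_axioms f_def gh.scale_def)
    moreover have "module_hom sh sh g"
      using \<phi>.add[of "(0, _)" "(0, _)"] \<phi>.scale[of _ "(0, _)"]
      by (auto simp: module_hom_def module_hom_axioms_def gh.m2.module_axioms g_def gh.scale_def)
    ultimately show "F \<in> ?S" using F by auto
  next
    fix F assume "F \<in> ?S"
    then obtain f g where f: "module_hom sg sg f" and g: "module_hom sh sh g"
      and F: "F = (\<lambda>z. map_prod f g (z 0))" by blast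
    interpret f: module_hom sg sg f by fact
    interpret g: module_hom sh sh g by fact
    have "module_hom gh.scale gh.scale (map_prod f g)"
      by unfold_locales (auto simp: f.add g.add f.scale g.scale gh.scale_def)
    then show "F \<in> ?R" by (auto simp: F f.zero g.zero)
  qed
  finally show ?thesis .
qed

section \<open>The differential on 2-cochains and 1-cochains\<close>

lemma mpl_delta_mpl_pi:
  assumes vs: "vector_space sg" "vector_space sh"
    and MB: "M \<in> bilinear_structures sg sh" and DB: "D \<in> bilinear_structures sg sh"
  defines "\<pi> \<equiv> bicrossed M" and "F \<equiv> bicrossed D"
  shows "mpl_delta sg sh M 2 (mpl_pi D) z =
    \<pi> (z 0) (F (z 1) (z 2)) + F (z 0) (\<pi> (z 1) (z 2)) + (\<pi> (z 1) (F (z 2) (z 0)) + F (z 1) (\<pi> (z 2) (z 0)))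
    + (\<pi> (z 2) (F (z 0) (z 1)) + F (z 2) (\<pi> (z 0) (z 1)))"
proof -
  interpret gh: vector_space "module_prod.scale sg sh"
    by (rule vector_space_module_prod(1)[OF vs])
  have t: "transpose 0 1 (2::nat) = 2" "transpose 0 (Suc 0) (2::nat) = 2"
    "transpose 1 2 (0::nat) = 0" "transpose (Suc 0) 2 (0::nat) = 0"
    by (simp_all add: transpose_def)
  \<comment> \<open>The shuffles insert the pairs (0, 1), (0, 2) and (1, 2) into the first slot of
    \<open>B\<close>. Swapping the odd middle pair makes the sum cyclic, and moving the inner
    bracket to the second slot produces the overall minus sign.\<close>
  have ins: "nr_insert (module_prod.scale sg sh) 1 1 (mpl_pi A) (mpl_pi B) z =
      - (bicrossed B (z 2) (bicrossed A (z 0) (z 1)) + bicrossed B (z 1) (bicrossed A (z 2) (z 0))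
        + bicrossed B (z 0) (bicrossed A (z 1) (z 2)))"
    if "A \<in> bilinear_structures sg sh" "B \<in> bilinear_structures sg sh" for A B
    unfolding gh.nr_insert_1_1 mpl_pi_eq_bicrossed
    using bicrossed_skew[OF that(1), of "z 0" "z 2"]
    by (simp add: t numeral_2_eq_2[symmetric] bicrossed_skew[OF that(2), of "bicrossed A _ _"]
      bicrossed_simps[OF that(2)])
  \<comment> \<open>Both maps have degree 1, so the sign \<open>(- 1) ^ (1 * 1)\<close> turns the
    difference of insertions into a sum, and the minus sign in \<open>mpl_delta\<close> cancels the
    one in \<open>ins\<close>.\<close>
  show ?thesis
    unfolding mpl_delta_def nr_bracket_def
    by (simp add: ins[unfolded One_nat_def] MB DB \<pi>_def F_def)
qed

text \<open>A 1-cochain has degree 0, so the sign in the bracket is +1. Inserting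
  \<open>\<pi>\<close> into \<open>\<phi>\<close> uses the single (2, 0)-shuffle; inserting
  \<open>\<phi>\<close> into \<open>\<pi>\<close> uses the two (1, 1)-shuffles, whose opposite signs
  and the skew-symmetry of \<open>\<pi>\<close> give a Leibniz sum.\<close>

lemma mpl_delta_map_prod:
  assumes vs: "vector_space sg" "vector_space sh"
    and MB: "M \<in> bilinear_structures sg sh"
  defines "\<pi> \<equiv> bicrossed M"
  shows "mpl_delta sg sh M 1 (\<lambda>z. \<phi> (z 0)) z =
    \<pi> (\<phi> (z 0)) (z 1) + \<pi> (z 0) (\<phi> (z 1)) - \<phi> (\<pi> (z 0) (z 1))"
proof -
  interpret gh: vector_space "module_prod.scale sg sh"
    by (rule vector_space_module_prod(1)[OF vs])
  show ?thesis
    unfolding mpl_delta_def nr_bracket_def diff_self_eq_0 gh.nr_insert_1_0 gh.nr_insert_0_1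
      mpl_pi_eq_bicrossed \<pi>_def
    using bicrossed_skew[OF MB, of "z 0" "\<phi> (z 1)"] by simp
qed

section \<open>Descent of the bijection to equivalence classes\<close>

theorem theorem5p2:
  fixes sg :: "'k::field_char_0 \<Rightarrow> 'g::ab_group_add \<Rightarrow> 'g"
    and sh :: "'k \<Rightarrow> 'h::ab_group_add \<Rightarrow> 'h"
    and brg :: "'g \<Rightarrow> 'g \<Rightarrow> 'g" and brh :: "'h \<Rightarrow> 'h \<Rightarrow> 'h"
    and \<rho> :: "'g \<Rightarrow> 'h \<Rightarrow> 'h" and \<psi> :: "'h \<Rightarrow> 'g \<Rightarrow> 'g"
  assumes "vector_space sg" and "vector_space sh"
    and "matched_pair sg sh brg brh \<rho> \<psi>"
  shows "\<exists>\<Phi>. bij_betw \<Phi>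
    (infinitesimal_deformations sg sh (brg, brh, \<rho>, \<psi>) //
      equivalent_deformations sg sh (brg, brh, \<rho>, \<psi>))
    (mpl_cohomology sg sh (brg, brh, \<rho>, \<psi>) 2)"
proof -
  note vs = assms(1,2)
  define M where "M = (brg, brh, \<rho>, \<psi>)"
  have MB: "M \<in> bilinear_structures sg sh"
    unfolding M_def by (rule matched_pair_bilinear_structures[OF assms(3)])
  note inf = infinitesimal_deformations_iff[OF assms, folded M_def]
  let ?I = "infinitesimal_deformations sg sh M" and ?Z = "mpl_cocycles sg sh M 2"
  let ?R = "equivalent_deformations sg sh M"
  let ?S = "{(F, F'). F \<in> ?Z \<and> F' \<in> ?Z \<and> (\<lambda>z. F z - F' z) \<in> mpl_coboundaries sg sh M 2}"
  \<comment> \<open>Cochains are functions of sequences; a sequence beginning with \<open>a\<close>,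
    \<open>b\<close> compares the underlying binary functions at these vectors.\<close>
  have binary_ext: "(\<lambda>z::nat \<Rightarrow> 'g \<times> 'h. f (z 0) (z 1)) = (\<lambda>z. g (z 0) (z 1)) \<longleftrightarrow> (\<forall>a b. f a b = g a b)"
    for f g :: "'g \<times> 'h \<Rightarrow> 'g \<times> 'h \<Rightarrow> 'g \<times> 'h"
  proof
    assume e: "(\<lambda>z::nat \<Rightarrow> _. f (z 0) (z 1)) = (\<lambda>z. g (z 0) (z 1))"
    show "\<forall>a b. f a b = g a b"
      using fun_cong[OF e, of "\<lambda>i. if i = 0 then _ else _"] by simp
  next
    show "(\<lambda>z::nat \<Rightarrow> 'g \<times> 'h. f (z 0) (z 1)) = (\<lambda>z. g (z 0) (z 1))" if "\<forall>a b. f a b = g a b"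
      by (intro ext that[rule_format])
  qed
  have inj: "inj_on mpl_pi (bilinear_structures sg sh)"
  proof (rule inj_onI)
    fix D D' assume D: "D \<in> bilinear_structures sg sh" "D' \<in> bilinear_structures sg sh"
      and e: "mpl_pi D = mpl_pi D'"
    have "bicrossed D = bicrossed D'"
      using e unfolding mpl_pi_eq_bicrossed[abs_def] binary_ext by blast
    then show "D = D'" by (rule bicrossed_inject[OF D])
  qed
  \<comment> \<open>The differential of \<open>mpl_pi D\<close> agrees term by term with the
    \<open>t\<close>-coefficient in \<open>inf\<close>.\<close>
  have cocycle: "mpl_pi D \<in> ?Z \<longleftrightarrow> D \<in> ?I" if D: "D \<in> bilinear_structures sg sh" for D
  proof -
    have "mpl_delta sg sh M 2 (mpl_pi D) = (\<lambda>z. 0) \<longleftrightarrow> (\<forall>a b c. let F = bicrossed D; \<pi> = bicrossed M in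
      \<pi> a (F b c) + F a (\<pi> b c) + (\<pi> b (F c a) + F b (\<pi> c a)) + (\<pi> c (F a b) + F c (\<pi> a b)) = 0)"
      (is "?L \<longleftrightarrow> (\<forall>a b c. ?J a b c)")
    proof
      show "\<forall>a b c. ?J a b c" if ?L
      proof (intro allI)
        fix a b c
        show "?J a b c"
          using fun_cong[OF \<open>?L\<close>, of "\<lambda>i. if i = 0 then a else if i = 1 then b else c"]
          unfolding mpl_delta_mpl_pi[OF vs MB D] by simp
      qed
      show ?L if "\<forall>a b c. ?J a b c"
        using that unfolding mpl_delta_mpl_pi[OF vs MB D, abs_def] Let_def by blast
    qed
    then show ?thesis
      using D by (auto simp: mpl_cocycles_def mpl_cochains_2[OF vs] inf Let_def)
  qed
  have bij: "bij_betw mpl_pi ?I ?Z"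
  proof -
    have "?I \<subseteq> bilinear_structures sg sh" using inf by blast
    moreover have "?Z \<subseteq> mpl_pi ` bilinear_structures sg sh"
      unfolding mpl_cochains_2[OF vs, symmetric] by (auto simp: mpl_cocycles_def)
    ultimately show ?thesis
      using cocycle inj unfolding bij_betw_def by (blast intro: inj_on_subset)
  qed
  have rel: "(D, D') \<in> ?R \<longleftrightarrow> (mpl_pi D, mpl_pi D') \<in> ?S" if D: "D \<in> ?I" "D' \<in> ?I" for D D'
  proof -
    have DB: "D \<in> bilinear_structures sg sh" "D' \<in> bilinear_structures sg sh"
      using D inf by blast+
    have "(\<lambda>z. mpl_pi D z - mpl_pi D' z) \<in> mpl_coboundaries sg sh M 2 \<longleftrightarrow>
        (\<exists>f g. module_hom sg sg f \<and> module_hom sh sh g \<and>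
          (\<lambda>z. mpl_pi D z - mpl_pi D' z) = mpl_delta sg sh M 1 (\<lambda>z. map_prod f g (z 0)))"
      unfolding mpl_coboundaries_def using mpl_cochains_1[OF vs] by auto
    \<comment> \<open>The same \<open>f\<close>, \<open>g\<close> serve on both sides: the 1-cochain
      bounding the difference of the cocycles is the first-order part of the morphism.\<close>
    also have "\<dots> \<longleftrightarrow> (\<exists>f g. module_hom sg sg f \<and> module_hom sh sh g \<and>
        matched_pair_hom (trunc_scale sg) (trunc_scale sh) (deformed M D)
          (trunc_scale sg) (trunc_scale sh) (deformed M D') (id_plus_t f) (id_plus_t g))"
      unfolding mpl_delta_map_prod[OF vs MB, abs_def] mpl_pi_eq_bicrossed
      using deformed_hom_iff[OF MB DB]
      by (subst binary_ext[of "\<lambda>a b. bicrossed D a b - bicrossed D' a b"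
        "\<lambda>a b. bicrossed M (map_prod _ _ a) b + bicrossed M a (map_prod _ _ b) - map_prod _ _ (bicrossed M a b)"]) blast
    finally show ?thesis
      using D bij by (auto simp: equivalent_deformations_def linear_iff_module_hom bij_betw_def)
  qed
  have "bij_betw ((`) mpl_pi) (?I // ?R) (?Z // ?S)"
    by (rule bij_betw_quotient[OF bij _ _ rel]) (auto simp: equivalent_deformations_def)
  then show ?thesis
    unfolding mpl_cohomology_def M_def by blast
qed

end
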